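(* Assume $A$ is associative and fix $k\in\mathbb{N}$. Then $\{\mathcal{P}_{\mathbf{k}}^{\mathcal{B}}\}_{|\mathbf{k}|=k}$ (with $\mathbf{k}\in\mathbb{N}^m$) is a right $A$-basis for $U_k^{\mathcal{B}}$. Namely, for all $P\in U_k^{\mathcal{B}}$, the equality \[P(x)=\sum_{|\mathbf{k}|=k}\mathcal{P}_{\mathbf{k}}^{\mathcal{B}}(x)\,\frac{1}{\mathbf{k}!}\,\nabla_{\mathcal{B}}^{(0,\mathbf{k})}P(0)\] holds true at all $x\in M$.
   Context: $\mathbb{N}$ includes $0$. $A$ is a finite-dimensional (unital) real $*$-algebra: a finite-dimensional real vector space with an $\mathbb{R}$-bilinear multiplication (here associative) and an involutive real-linear antiautomorphism $x\mapsto x^c$; $\mathbb{R}$ is identified with $\mathbb{R}1$. Set $t(x)=x+x^c$, $n(x)=xx^c$, $\mathbb{S}_A=\{x\in A:t(x)=0,\ n(x)=1\}$, assumed nonempty, and $Q_A=\bigcup_{J\in\mathbb{S}_A}(\mathbb{R}+J\mathbb{R})$. A hypercomplex subspace of $A$ is a real vector subspace $M$ with $\mathbb{R}\subsetneq M\subseteq Q_A$; a hypercomplex basis of $M$ is an ordered real basis $(v_0,\ldots,v_m)$ with $m\ge1$, $v_0=1$, $v_s\in\mathbb{S}_A$ and $v_sv_u=-v_uv_s$ for distinct $s,u\in\{1,\ldots,m\}$. Setting. $M$ is a hypercomplex subspace of $A$ with a fixed hypercomplex basis $\mathcal{B}=(v_0,\ldots,v_m)$; points of $M$ are written $x=\sum_{s=0}^mx_sv_s$.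 For a $\mathscr{C}^1$ function $\phi$ from an open subset of $M$ to $A$: $\partial_s\phi(x)=\lim_{\mathbb{R}\ni\varepsilon\to0}\varepsilon^{-1}(\phi(x+\varepsilon v_s)-\phi(x))$ and $\overline{\partial}_{\mathcal{B}}\phi=\sum_{s=0}^mv_s\,\partial_s\phi$. $\phi$ is left-monogenic with respect to $\mathcal{B}$ if $\overline{\partial}_{\mathcal{B}}\phi\equiv0$. For $\mathbf{h}=(h_0,\ldots,h_m)\in\mathbb{N}^{m+1}$, $\nabla_{\mathcal{B}}^{\mathbf{h}}\phi=\partial_0^{h_0}\partial_1^{h_1}\cdots\partial_m^{h_m}\phi$. $U_k^{\mathcal{B}}$ is the right $A$-module of left-monogenic functions $P:M\to A$ such that $P(x_0+x_1v_1+\cdots+x_mv_m)$ is a $k$-homogeneous polynomial map in the real variables $x_0,\ldots,x_m$. For $\mathbf{k}=(k_1,\ldots,k_m)$: $|\mathbf{k}|=\sum_sk_s$, $\mathbf{k}!=\prod_sk_s!$; $\epsilon_1,\ldots,\epsilon_m$ are the standard unit vectors of $\mathbb{N}^m$. Hypercomplex Fueter variables: $\zeta_s^{\mathcal{B}}=x_s-x_0v_s$, $1\le s\le m$. Hypercomplex Fueter polynomial functions $\mathcal{P}_{\mathbf{k}}^{\mathcal{B}}:M\to A$, $\mathbf{k}\in\mathbb{Z}^m$: $\mathcal{P}_{\mathbf{k}}^{\mathcal{B}}\equiv0$ if $\mathbf{k}\notin\mathbb{N}^m$; $\mathcal{P}_{(0,\ldots,0)}^{\mathcal{B}}\equiv1$;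 and $|\mathbf{k}|\,\mathcal{P}_{\mathbf{k}}^{\mathcal{B}}(x)=\sum_{s=1}^mk_s\,\mathcal{P}_{\mathbf{k}-\epsilon_s}^{\mathcal{B}}(x)\,\zeta_s^{\mathcal{B}}$ if $\mathbf{k}\in\mathbb{N}^m\setminus\{(0,\ldots,0)\}$. *)

theory Defs
  imports "HOL-Analysis.Analysis"
begin

text \<open>
  The finite-dimensional associative unital real algebra is a type of sort
  \<open>{real_algebra_1, euclidean_space}\<close>. The class \<open>euclidean_space\<close> supplies finite dimension and the
  usual topology; its norm is not assumed to be compatible with the multiplication, so no
  algebra is excluded. The subfield of reals is \<open>range of_real\<close>.
\<close>

definition star_involution :: "('a::real_algebra_1 \<Rightarrow> 'a) \<Rightarrow> bool" where
  "star_involution c \<longleftrightarrow> linear c \<and> (\<forall>x. c (c x) = x) \<and> (\<forall>x y. c (x * y) = c y * c x)"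

definition star_trace :: "('a::real_algebra_1 \<Rightarrow> 'a) \<Rightarrow> 'a \<Rightarrow> 'a" where
  "star_trace c x = x + c x"

definition star_norm :: "('a::real_algebra_1 \<Rightarrow> 'a) \<Rightarrow> 'a \<Rightarrow> 'a" where
  "star_norm c x = x * c x"

definition imag_units :: "('a::real_algebra_1 \<Rightarrow> 'a) \<Rightarrow> 'a set" where
  "imag_units c = {x. star_trace c x = 0 \<and> star_norm c x = 1}"

definition quadratic_cone :: "('a::real_algebra_1 \<Rightarrow> 'a) \<Rightarrow> 'a set" where
  "quadratic_cone c = (\<Union>J\<in>imag_units c. {of_real a + J * of_real b | a b. True})"

definition hypercomplex_subspace :: "('a::real_algebra_1 \<Rightarrow> 'a) \<Rightarrow> 'a set \<Rightarrow> bool" where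
  "hypercomplex_subspace c M \<longleftrightarrow>
     subspace M \<and> range of_real \<subset> M \<and> M \<subseteq> quadratic_cone c"

text \<open>The basis \<open>(v 0, \<dots>, v m)\<close> is given by the values of \<open>v\<close> on \<open>{..m}\<close>; other values are irrelevant.\<close>

definition hypercomplex_basis ::
    "('a::real_algebra_1 \<Rightarrow> 'a) \<Rightarrow> 'a set \<Rightarrow> nat \<Rightarrow> (nat \<Rightarrow> 'a) \<Rightarrow> bool" where
  "hypercomplex_basis c M m v \<longleftrightarrow>
     1 \<le> m \<and>
     inj_on v {..m} \<and> independent (v ` {..m}) \<and> span (v ` {..m}) = M \<and>
     v 0 = 1 \<and>
     (\<forall>s\<in>{1..m}. v s \<in> imag_units c) \<and>
     (\<forall>s\<in>{1..m}. \<forall>u\<in>{1..m}. s \<noteq> u \<longrightarrow> v s * v u = - (v u * v s))"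

text \<open>The real coordinate \<open>x\<^sub>s\<close> of a point \<open>x\<close> of \<open>M\<close>.\<close>

definition coord :: "(nat \<Rightarrow> 'a::real_algebra_1) \<Rightarrow> nat \<Rightarrow> nat \<Rightarrow> 'a \<Rightarrow> real" where
  "coord v m s x = representation (v ` {..m}) x (v s)"

text \<open>
  A function from a subset of \<open>M\<close> to the algebra is represented by a function on the whole type;
  all notions below depend only on its values on that subset. The limit in \<open>partial\<close> is
  meaningful where it exists, which \<open>C1_on\<close> demands. Continuous differentiability is
  expressed by existence and continuity of the partial derivatives along the basis of \<open>M\<close>,
  since \<open>M\<close> need not be open in the algebra.
\<close>

definition diff_quot ::
    "(nat \<Rightarrow> 'a::{real_algebra_1,euclidean_space}) \<Rightarrow> nat \<Rightarrow> ('a \<Rightarrow> 'a) \<Rightarrow> 'a \<Rightarrow> real \<Rightarrow> 'a" where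
  "diff_quot v s \<phi> x \<epsilon> = inverse \<epsilon> *\<^sub>R (\<phi> (x + \<epsilon> *\<^sub>R v s) - \<phi> x)"

definition partial ::
    "(nat \<Rightarrow> 'a::{real_algebra_1,euclidean_space}) \<Rightarrow> nat \<Rightarrow> ('a \<Rightarrow> 'a) \<Rightarrow> 'a \<Rightarrow> 'a" where
  "partial v s \<phi> x = Lim (at 0) (diff_quot v s \<phi> x)"

definition C1_on ::
    "(nat \<Rightarrow> 'a::{real_algebra_1,euclidean_space}) \<Rightarrow> nat \<Rightarrow> 'a set \<Rightarrow> ('a \<Rightarrow> 'a) \<Rightarrow> bool" where
  "C1_on v m \<Omega> \<phi> \<longleftrightarrow>
     (\<forall>s\<le>m. (\<forall>x\<in>\<Omega>. \<exists>L. (diff_quot v s \<phi> x \<longlongrightarrow> L) (at 0)) \<and> continuous_on \<Omega> (partial v s \<phi>))"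

definition dbar ::
    "(nat \<Rightarrow> 'a::{real_algebra_1,euclidean_space}) \<Rightarrow> nat \<Rightarrow> ('a \<Rightarrow> 'a) \<Rightarrow> 'a \<Rightarrow> 'a" where
  "dbar v m \<phi> x = (\<Sum>s\<le>m. v s * partial v s \<phi> x)"

definition left_monogenic ::
    "(nat \<Rightarrow> 'a::{real_algebra_1,euclidean_space}) \<Rightarrow> nat \<Rightarrow> 'a set \<Rightarrow> ('a \<Rightarrow> 'a) \<Rightarrow> bool" where
  "left_monogenic v m \<Omega> \<phi> \<longleftrightarrow> C1_on v m \<Omega> \<phi> \<and> (\<forall>x\<in>\<Omega>. dbar v m \<phi> x = 0)"

text \<open>\<open>nabla v m h\<close> is \<open>\<partial>\<^sub>0\<close> iterated \<open>h 0\<close> times, applied after \<open>\<partial>\<^sub>1\<close> iterated \<open>h 1\<close> times, and so on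
  up to the innermost \<open>\<partial>\<^sub>m\<close>.\<close>

definition nabla ::
    "(nat \<Rightarrow> 'a::{real_algebra_1,euclidean_space}) \<Rightarrow> nat \<Rightarrow> (nat \<Rightarrow> nat) \<Rightarrow> ('a \<Rightarrow> 'a) \<Rightarrow> 'a \<Rightarrow> 'a" where
  "nabla v m h \<phi> = foldr (\<lambda>s. partial v s ^^ h s) [0..<Suc m] \<phi>"

text \<open>Multi-indices over the index set \<open>S\<close> of total degree \<open>k\<close>, extended by zero outside \<open>S\<close>
  so that distinct functions are distinct multi-indices.\<close>

definition multi_indices :: "nat set \<Rightarrow> nat \<Rightarrow> (nat \<Rightarrow> nat) set" where
  "multi_indices S k = {\<alpha>. (\<forall>s. s \<notin> S \<longrightarrow> \<alpha> s = 0) \<and> sum \<alpha> S = k}"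

definition homogeneous_polynomial_map ::
    "(nat \<Rightarrow> 'a::real_algebra_1) \<Rightarrow> nat \<Rightarrow> nat \<Rightarrow> ('a \<Rightarrow> 'a) \<Rightarrow> bool" where
  "homogeneous_polynomial_map v m k P \<longleftrightarrow>
     (\<exists>a :: (nat \<Rightarrow> nat) \<Rightarrow> 'a. \<forall>x :: nat \<Rightarrow> real.
        P (\<Sum>s\<le>m. x s *\<^sub>R v s) = (\<Sum>\<alpha>\<in>multi_indices {..m} k. (\<Prod>s\<le>m. x s ^ \<alpha> s) *\<^sub>R a \<alpha>))"

definition monogenic_polynomials ::
    "'a::{real_algebra_1,euclidean_space} set \<Rightarrow> (nat \<Rightarrow> 'a) \<Rightarrow> nat \<Rightarrow> nat \<Rightarrow> ('a \<Rightarrow> 'a) set" where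
  "monogenic_polynomials M v m k =
     {P. left_monogenic v m M P \<and> homogeneous_polynomial_map v m k P}"

definition fueter_variable :: "(nat \<Rightarrow> 'a::real_algebra_1) \<Rightarrow> nat \<Rightarrow> nat \<Rightarrow> 'a \<Rightarrow> 'a" where
  "fueter_variable v m s x = of_real (coord v m s x) - of_real (coord v m 0 x) * v s"

text \<open>Only the values of the multi-index \<open>k\<close> on \<open>{1..m}\<close> matter. The defining recursion is
  divided by \<open>\<bar>k\<bar>\<close>, which is positive in the last branch.\<close>

function fueter_poly ::
    "(nat \<Rightarrow> 'a::real_algebra_1) \<Rightarrow> nat \<Rightarrow> (nat \<Rightarrow> int) \<Rightarrow> 'a \<Rightarrow> 'a" where
  "fueter_poly v m k x =
     (if \<exists>s\<in>{1..m}. k s < 0 then 0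
      else if \<forall>s\<in>{1..m}. k s = 0 then 1
      else inverse (real_of_int (sum k {1..m})) *\<^sub>R
             (\<Sum>s\<in>{1..m}. of_int (k s) * fueter_poly v m (k(s := k s - 1)) x * fueter_variable v m s x))"
  by pat_completeness auto
termination
proof (relation "Wellfounded.measure (\<lambda>(v, m, k, x). nat (sum k {1..m}))", goal_cases)
  case 1
  show ?case by simp
next
  case (2 v m k x s)
  have nonneg: "\<And>u. u \<in> {1..m} \<Longrightarrow> 0 \<le> k u" using 2(1) by force
  obtain w where w: "w \<in> {1..m}" "k w \<noteq> 0" using 2(2) by blast
  have "0 < k w" using nonneg[OF w(1)] w(2) by linarith
  also have "k w \<le> sum k {1..m}" using w(1) nonneg by (intro member_le_sum) auto
  finally have pos: "0 < sum k {1..m}" .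
  have "sum (k(s := k s - 1)) {1..m} = sum k {1..m} - 1"
  proof -
    have "sum (k(s := k s - 1)) {1..m} = (k s - 1) + sum (k(s := k s - 1)) ({1..m} - {s})"
      using 2(3) by (subst sum.remove[of _ s]) auto
    also have "sum (k(s := k s - 1)) ({1..m} - {s}) = sum k ({1..m} - {s})"
      by (intro sum.cong) auto
    also have "(k s - 1) + \<dots> = sum k {1..m} - 1"
      using 2(3) sum.remove[of "{1..m}" s k] by simp
    finally show ?thesis .
  qed
  then show ?case using pos by simp
qed

text \<open>Since this recursion does not terminate as a rewrite rule, it is not used automatically.\<close>

declare fueter_poly.simps [simp del]

text \<open>
  For a set \<open>U\<close> of functions on \<open>M\<close> (two functions being identified when they agree on \<open>M\<close>), a family
  \<open>b\<close> over a finite index set \<open>I\<close> is a right basis if \<open>U\<close> is exactly the set of its right linear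
  combinations and the coefficients of a vanishing combination vanish. In particular all
  \<open>b i\<close> lie in \<open>U\<close>, and \<open>U\<close> is closed under sums and right multiplication by scalars.
\<close>

definition right_span_on :: "'x set \<Rightarrow> 'i set \<Rightarrow> ('i \<Rightarrow> 'x \<Rightarrow> 'a::ring_1) \<Rightarrow> ('x \<Rightarrow> 'a) set" where
  "right_span_on M I b = {f. \<exists>a. \<forall>x\<in>M. f x = (\<Sum>i\<in>I. b i x * a i)}"

definition right_independent_on :: "'x set \<Rightarrow> 'i set \<Rightarrow> ('i \<Rightarrow> 'x \<Rightarrow> 'a::ring_1) \<Rightarrow> bool" where
  "right_independent_on M I b \<longleftrightarrow>
     (\<forall>a. (\<forall>x\<in>M. (\<Sum>i\<in>I. b i x * a i) = 0) \<longrightarrow> (\<forall>i\<in>I. a i = 0))"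

definition right_basis_on ::
    "'x set \<Rightarrow> ('x \<Rightarrow> 'a) set \<Rightarrow> 'i set \<Rightarrow> ('i \<Rightarrow> 'x \<Rightarrow> 'a::ring_1) \<Rightarrow> bool" where
  "right_basis_on M U I b \<longleftrightarrow>
     finite I \<and> right_independent_on M I b \<and> right_span_on M I b = U"

end

theory Submission
  imports Defs
begin

text \<open>
  A polynomial solution of \<open>\<Sum>\<^sub>s v\<^sub>s \<partial>\<^sub>s f = 0\<close> is governed by an initial value problem: as \<open>v\<^sub>0 = 1\<close>, the equation
  reads \<open>\<partial>\<^sub>0 f = - (\<Sum>\<^sub>s\<^sub>\<ge>\<^sub>1 v\<^sub>s \<partial>\<^sub>s f)\<close>, so \<open>f\<close> is determined by its restriction to the hyperplane \<open>x\<^sub>0 = 0\<close>.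
  This is \<open>monogenic_polynomials_eqI\<close>, proved by recursion on the coefficients. The Fueter polynomial
  \<open>P\<^sub>\<kappa>\<close> is the monogenic extension of the monomial \<open>x\<^sup>\<kappa>\<close> in \<open>x\<^sub>1, \<dots>, x\<^sub>m\<close>: it restricts to \<open>x\<^sup>\<kappa>\<close> on the
  hyperplane (\<open>fueter_on_hyperplane\<close>), and it is monogenic (\<open>fueter_combination_monogenic\<close>). Hence the
  expansion of a monogenic \<open>P\<close> is the expansion of its restriction into monomials. Its coefficients
  are those \<open>a\<^sub>\<alpha>\<close> of \<open>P\<close> with \<open>\<alpha>\<^sub>0 = 0\<close>, and \<open>h! a\<^sub>h\<close> is the iterated derivative of \<open>P\<close> with index \<open>h\<close> at \<open>0\<close>
  (\<open>nabla_hpoly\<close>). Linear independence of monomials gives independence of the \<open>P\<^sub>\<kappa>\<close>.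

  Monogenicity rests on two formulas: \<open>\<partial>\<^sub>s P\<^sub>\<kappa> = \<kappa>\<^sub>s P\<^bsub>\<kappa> - \<epsilon>\<^sub>s\<^esub>\<close> for \<open>s \<ge> 1\<close> and
  \<open>\<partial>\<^sub>0 P\<^sub>\<kappa> = - (\<Sum>\<^sub>s \<kappa>\<^sub>s v\<^sub>s P\<^bsub>\<kappa> - \<epsilon>\<^sub>s\<^esub>)\<close>. Both follow by differentiating the recursion, and the second needs
  the identity \<open>\<Sum>\<^sub>s \<kappa>\<^sub>s v\<^sub>s P\<^bsub>\<kappa> - \<epsilon>\<^sub>s\<^esub> = \<Sum>\<^sub>s \<kappa>\<^sub>s P\<^bsub>\<kappa> - \<epsilon>\<^sub>s\<^esub> v\<^sub>s\<close> (\<open>fueter_commutation\<close>). The reason for it is that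
  \<open>P\<^sub>\<kappa>\<close> is, up to a scalar, the coefficient of \<open>t\<^sup>\<kappa>\<close> in a power of \<open>\<Sum>\<^sub>s t\<^sub>s \<zeta>\<^sub>s = (\<Sum>\<^sub>s t\<^sub>s x\<^sub>s) - x\<^sub>0 (\<Sum>\<^sub>s t\<^sub>s v\<^sub>s)\<close>, and
  this element commutes with \<open>\<Sum>\<^sub>s t\<^sub>s v\<^sub>s\<close> for real \<open>t\<^sub>s\<close>; the proof below expresses this through the
  symmetry of iterated lowering of indices.
\<close>

section \<open>Derivatives along frame directions\<close>

text \<open>
  The derivatives below are computed for \<open>\<epsilon> \<mapsto> f (x + \<epsilon> v\<^sub>s)\<close> as functions of one real variable, where the
  calculus of vector derivatives applies; this lemma and the next translate the results back to
  difference quotients.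
\<close>

lemma tendsto_diff_quot:
  assumes "((\<lambda>\<epsilon>. f (x + \<epsilon> *\<^sub>R v s)) has_vector_derivative L) (at 0)"
  shows "(diff_quot v s f x \<longlongrightarrow> L) (at 0)"
proof -
  have "(\<lambda>h. norm (f (x + h *\<^sub>R v s) - f x - h *\<^sub>R L) / norm h) \<midarrow>0\<rightarrow> 0"
    using assms unfolding has_vector_derivative_def has_derivative_at by simp
  moreover have "norm (f (x + h *\<^sub>R v s) - f x - h *\<^sub>R L) / norm h = norm (diff_quot v s f x h - L)"
    if "h \<noteq> 0" for h
  proof -
    have "diff_quot v s f x h - L = inverse h *\<^sub>R (f (x + h *\<^sub>R v s) - f x - h *\<^sub>R L)"
      using that by (simp add: diff_quot_def scaleR_diff_right)
    then show ?thesis by (simp add: divide_inverse mult.commute)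
  qed
  then have "\<forall>\<^sub>F h in at 0. norm (f (x + h *\<^sub>R v s) - f x - h *\<^sub>R L) / norm h
      = norm (diff_quot v s f x h - L)"
    by (simp add: eventually_at_filter)
  ultimately have "((\<lambda>h. norm (diff_quot v s f x h - L)) \<longlongrightarrow> 0) (at 0)"
    using tendsto_cong by fastforce
  then show ?thesis
    using LIM_zero_cancel tendsto_norm_zero_iff by blast
qed

lemma partial_eqI:
  assumes "((\<lambda>\<epsilon>. f (x + \<epsilon> *\<^sub>R v s)) has_vector_derivative L) (at 0)"
  shows "partial v s f x = L"
  unfolding partial_def using tendsto_diff_quot[of f x v s L, OF assms] by (intro tendsto_Lim) auto

text \<open>
  The norm need not be submultiplicative, but in finite dimension every bilinear map is bounded.
  This makes the product rule available.
\<close>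

lemma bounded_bilinear_mult_euclidean:
  "bounded_bilinear ((*) :: 'a::{real_algebra_1,euclidean_space} \<Rightarrow> 'a \<Rightarrow> 'a)"
  by (subst bilinear_conv_bounded_bilinear[symmetric])
     (auto simp: bilinear_def linear_iff algebra_simps)

section \<open>Multi-indices\<close>

abbreviation raise :: "nat \<Rightarrow> (nat \<Rightarrow> nat) \<Rightarrow> nat \<Rightarrow> nat" where
  "raise s \<alpha> \<equiv> \<alpha>(s := Suc (\<alpha> s))"

abbreviation lower :: "nat \<Rightarrow> (nat \<Rightarrow> nat) \<Rightarrow> nat \<Rightarrow> nat" where
  "lower s \<alpha> \<equiv> \<alpha>(s := \<alpha> s - 1)"

lemma finite_multi_indices:
  assumes "finite S" shows "finite (multi_indices S k)"
proof (rule finite_subset)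
  show "multi_indices S k \<subseteq> {\<alpha>. \<forall>s. (s \<in> S \<longrightarrow> \<alpha> s \<in> {..k}) \<and> (s \<notin> S \<longrightarrow> \<alpha> s = 0)}"
    using assms member_le_sum[of _ S] by (force simp: multi_indices_def)
  show "finite {\<alpha>. \<forall>s. (s \<in> S \<longrightarrow> \<alpha> s \<in> {..k}) \<and> (s \<notin> S \<longrightarrow> \<alpha> s = (0::nat))}"
    by (rule finite_set_of_finite_funs) (use assms in auto)
qed

lemma sum_raise:
  assumes "finite S" "s \<in> S" shows "sum (raise s \<alpha>) S = Suc (sum \<alpha> S)"
  using assms by (simp add: sum.remove[of S s])

lemma raise_multi_indices:
  assumes "finite S" "s \<in> S" "\<alpha> \<in> multi_indices S k"
  shows "raise s \<alpha> \<in> multi_indices S (Suc k)"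
  using assms sum_raise[OF assms(1,2), of \<alpha>] by (auto simp: multi_indices_def)

lemma multi_indices_zero: "finite S \<Longrightarrow> multi_indices S 0 = {\<lambda>_. 0}"
  by (auto simp: multi_indices_def fun_eq_iff)

text \<open>
  The reindexing \<open>\<alpha> = \<beta> + \<epsilon>\<^sub>s\<close> shared by differentiation in direction \<open>s\<close> and by multiplication with
  the coordinate \<open>x\<^sub>s\<close>: in both cases the terms with \<open>\<alpha>\<^sub>s = 0\<close> vanish.
\<close>

lemma sum_multi_indices_Suc:
  fixes g :: "(nat \<Rightarrow> nat) \<Rightarrow> 'b::comm_monoid_add"
  assumes "finite S" "s \<in> S" and "\<And>\<alpha>. \<alpha> s = 0 \<Longrightarrow> g \<alpha> = 0"
  shows "(\<Sum>\<alpha>\<in>multi_indices S (Suc k). g \<alpha>) = (\<Sum>\<beta>\<in>multi_indices S k. g (raise s \<beta>))"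
proof -
  have "(\<Sum>\<beta>\<in>multi_indices S k. g (raise s \<beta>)) = sum g {\<alpha>\<in>multi_indices S (Suc k). \<alpha> s \<noteq> 0}"
  proof (rule sum.reindex_bij_witness[of _ "lower s" "raise s"])
    fix \<alpha> assume \<alpha>: "\<alpha> \<in> {\<alpha>\<in>multi_indices S (Suc k). \<alpha> s \<noteq> 0}"
    then show eq: "raise s (lower s \<alpha>) = \<alpha>" by auto
    show "lower s \<alpha> \<in> multi_indices S k"
      using \<alpha> sum_raise[OF assms(1,2), of "lower s \<alpha>"] assms(2) eq
      by (auto simp: multi_indices_def)
  qed (use raise_multi_indices[OF assms(1,2)] in auto)
  also have "\<dots> = sum g (multi_indices S (Suc k))"
    using assms by (intro sum.mono_neutral_left finite_multi_indices) auto
  finally show ?thesis by simp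
qed

section \<open>Coordinates\<close>

text \<open>
  The part of a hypercomplex basis that fixes the coordinates and normalises the coefficient of
  \<open>\<partial>\<^sub>0\<close> in the Cauchy-Riemann operator to \<open>1\<close>.
\<close>

locale coordinate_frame =
  fixes v :: "nat \<Rightarrow> 'a::{real_algebra_1,euclidean_space}" and m :: nat
  assumes inj: "inj_on v {..m}" and indep: "independent (v ` {..m})" and v0: "v 0 = 1"
begin

abbreviation "M \<equiv> span (v ` {..m})"

lemma frame_in_M: "s \<le> m \<Longrightarrow> v s \<in> M"
  by (simp add: span_base)

lemma shift_in_M: "x \<in> M \<Longrightarrow> s \<le> m \<Longrightarrow> x + r *\<^sub>R v s \<in> M"
  by (simp add: frame_in_M span_add span_scale)

lemma coord_shift:
  assumes "x \<in> M" "s \<le> m" "u \<le> m"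
  shows "coord v m u (x + r *\<^sub>R v s) = coord v m u x + (if u = s then r else 0)"
  using assms inj indep frame_in_M
  by (auto simp: coord_def representation_add representation_scale representation_basis span_scale
      dest: inj_onD)

lemma sum_coord: "x \<in> M \<Longrightarrow> (\<Sum>s\<le>m. coord v m s x *\<^sub>R v s) = x"
  using sum_representation_eq[OF indep, of x "v ` {..m}"] inj
  by (simp add: sum.reindex coord_def)

lemma coord_sum:
  assumes "s \<le> m" shows "coord v m s (\<Sum>i\<le>m. y i *\<^sub>R v i) = y s"
proof -
  have "coord v m s (\<Sum>i\<le>m. y i *\<^sub>R v i) = (\<Sum>i\<le>m. y i * (if v s = v i then 1 else 0))"
    using frame_in_M indep unfolding coord_def
    by (subst representation_sum)
      (auto intro!: sum.cong span_scale simp: representation_scale representation_basis)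
  also have "\<dots> = (\<Sum>i\<le>m. if i = s then y s else 0)"
    using assms inj by (intro sum.cong) (auto dest: inj_onD)
  finally show ?thesis using assms by simp
qed

text \<open>
  On the span a coordinate agrees with a linear functional defined on the whole space, and
  such functionals are continuous in finite dimension.
\<close>

lemma continuous_on_coord:
  assumes "s \<le> m" shows "continuous_on M (coord v m s)"
proof -
  obtain g :: "'a \<Rightarrow> real" where g: "linear g" "\<forall>b\<in>v ` {..m}. g b = (if b = v s then 1 else 0)"
    using linear_independent_extend[OF indep, of "\<lambda>b. if b = v s then 1 else 0"] by blast
  have "g x = coord v m s x" if "x \<in> M" for x
  proof -
    have "g x = g (\<Sum>i\<le>m. coord v m i x *\<^sub>R v i)" using sum_coord[OF that] by simp
    also have "\<dots> = (\<Sum>i\<le>m. coord v m i x * g (v i))"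
      by (simp add: linear_sum[OF g(1)] linear_cmul[OF g(1)])
    also have "\<dots> = (\<Sum>i\<le>m. if i = s then coord v m s x else 0)"
      using g(2) assms inj by (intro sum.cong) (auto dest: inj_onD)
    finally show ?thesis using assms by simp
  qed
  moreover have "continuous_on M g"
    using g(1) by (simp add: linear_continuous_on linear_conv_bounded_linear)
  ultimately show ?thesis by (simp cong: continuous_on_cong)
qed

section \<open>Homogeneous polynomials and their coefficients\<close>

definition monomial :: "(nat \<Rightarrow> nat) \<Rightarrow> 'a \<Rightarrow> real" where
  "monomial \<alpha> x = (\<Prod>s\<le>m. coord v m s x ^ \<alpha> s)"

definition hpoly :: "nat \<Rightarrow> ((nat \<Rightarrow> nat) \<Rightarrow> 'a) \<Rightarrow> 'a \<Rightarrow> 'a" where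
  "hpoly k a x = (\<Sum>\<alpha>\<in>multi_indices {..m} k. monomial \<alpha> x *\<^sub>R a \<alpha>)"

lemma homogeneous_polynomial_map_iff:
  "homogeneous_polynomial_map v m k P \<longleftrightarrow> (\<exists>a. \<forall>x\<in>M. P x = hpoly k a x)"
proof -
  have "(\<forall>y. P (\<Sum>s\<le>m. y s *\<^sub>R v s) = (\<Sum>\<alpha>\<in>multi_indices {..m} k. (\<Prod>s\<le>m. y s ^ \<alpha> s) *\<^sub>R a \<alpha>))
    \<longleftrightarrow> (\<forall>x\<in>M. P x = hpoly k a x)" (is "?L \<longleftrightarrow> ?R") for a
  proof
    assume ?L
    show ?R
    proof
      fix x assume "x \<in> M"
      then show "P x = hpoly k a x"
        using \<open>?L\<close>[rule_format, of "\<lambda>s. coord v m s x"] by (simp add: sum_coord hpoly_def monomial_def)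
    qed
  next
    assume ?R
    show ?L
    proof
      fix y :: "nat \<Rightarrow> real"
      have "(\<Sum>s\<le>m. y s *\<^sub>R v s) \<in> M" by (intro span_sum span_scale frame_in_M) simp
      then show "P (\<Sum>s\<le>m. y s *\<^sub>R v s) = (\<Sum>\<alpha>\<in>multi_indices {..m} k. (\<Prod>s\<le>m. y s ^ \<alpha> s) *\<^sub>R a \<alpha>)"
        using \<open>?R\<close> by (simp add: hpoly_def monomial_def coord_sum)
    qed
  qed
  then show ?thesis by (simp add: homogeneous_polynomial_map_def)
qed

lemma continuous_on_hpoly: "continuous_on M (hpoly k a)"
  unfolding hpoly_def monomial_def
  by (intro continuous_intros continuous_on_coord) auto

lemma monomial_remove:
  "s \<le> m \<Longrightarrow> monomial \<alpha> x = coord v m s x ^ \<alpha> s * (\<Prod>u\<in>{..m} - {s}. coord v m u x ^ \<alpha> u)"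
  unfolding monomial_def by (subst prod.remove[of _ s]) auto

lemma monomial_raise:
  assumes "s \<le> m" shows "monomial (raise s \<alpha>) x = coord v m s x * monomial \<alpha> x"
proof -
  have "(\<Prod>u\<in>{..m} - {s}. coord v m u x ^ raise s \<alpha> u) = (\<Prod>u\<in>{..m} - {s}. coord v m u x ^ \<alpha> u)"
    by (intro prod.cong) auto
  then show ?thesis using monomial_remove[OF assms] by simp
qed

lemma has_vector_derivative_monomial:
  assumes "x \<in> M" "s \<le> m"
  shows "((\<lambda>\<epsilon>. monomial \<alpha> (x + \<epsilon> *\<^sub>R v s)) has_vector_derivative \<alpha> s * monomial (lower s \<alpha>) x) (at 0)"
proof -
  define q where "q = (\<Prod>u\<in>{..m} - {s}. coord v m u x ^ \<alpha> u)"
  have "(\<Prod>u\<in>{..m} - {s}. coord v m u (x + \<epsilon> *\<^sub>R v s) ^ \<alpha> u) = q" for \<epsilon>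
    unfolding q_def using assms by (intro prod.cong) (auto simp: coord_shift)
  then have "(\<lambda>\<epsilon>. monomial \<alpha> (x + \<epsilon> *\<^sub>R v s)) = (\<lambda>\<epsilon>. (coord v m s x + \<epsilon>) ^ \<alpha> s * q)"
    using assms by (simp add: monomial_remove coord_shift)
  moreover have "monomial (lower s \<alpha>) x = coord v m s x ^ (\<alpha> s - 1) * q"
    using assms by (simp add: monomial_remove q_def)
  ultimately show ?thesis
    unfolding has_real_derivative_iff_has_vector_derivative[symmetric]
    by (auto intro!: derivative_eq_intros)
qed

text \<open>
  The coefficients of \<open>\<partial>\<^sub>s (\<Sum>\<^sub>\<alpha> x\<^sup>\<alpha> a\<^sub>\<alpha>)\<close>.
\<close>

definition shift_coeffs :: "nat \<Rightarrow> ((nat \<Rightarrow> nat) \<Rightarrow> 'a) \<Rightarrow> (nat \<Rightarrow> nat) \<Rightarrow> 'a" where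
  "shift_coeffs s a \<alpha> = real (Suc (\<alpha> s)) *\<^sub>R a (raise s \<alpha>)"

lemma has_vector_derivative_hpoly:
  assumes "x \<in> M" "s \<le> m"
  shows "((\<lambda>\<epsilon>. hpoly (Suc k) a (x + \<epsilon> *\<^sub>R v s)) has_vector_derivative hpoly k (shift_coeffs s a) x) (at 0)"
proof -
  have "((\<lambda>\<epsilon>. hpoly (Suc k) a (x + \<epsilon> *\<^sub>R v s)) has_vector_derivative
     (\<Sum>\<alpha>\<in>multi_indices {..m} (Suc k). (\<alpha> s * monomial (lower s \<alpha>) x) *\<^sub>R a \<alpha>)) (at 0)"
    unfolding hpoly_def
    by (intro has_vector_derivative_sum bounded_linear.has_vector_derivative[OF bounded_linear_scaleR_left]
        has_vector_derivative_monomial assms)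
  also have "(\<Sum>\<alpha>\<in>multi_indices {..m} (Suc k). (\<alpha> s * monomial (lower s \<alpha>) x) *\<^sub>R a \<alpha>)
      = hpoly k (shift_coeffs s a) x"
    using assms by (subst sum_multi_indices_Suc[of _ s])
      (auto simp: hpoly_def shift_coeffs_def algebra_simps)
  finally show ?thesis .
qed

text \<open>
  Moving in a frame direction does not leave the span, so derivatives at points of the span depend
  only on the values there. Functions in the module are known on the span only.
\<close>

lemma has_vector_derivative_cong_M:
  assumes "\<forall>x\<in>M. f x = g x" "x \<in> M" "s \<le> m"
  shows "((\<lambda>\<epsilon>. f (x + \<epsilon> *\<^sub>R v s)) has_vector_derivative L) (at 0) \<longleftrightarrow>
    ((\<lambda>\<epsilon>. g (x + \<epsilon> *\<^sub>R v s)) has_vector_derivative L) (at 0)"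
  using assms shift_in_M by simp

lemma partial_hpoly:
  assumes "\<forall>x\<in>M. f x = hpoly (Suc k) a x" "x \<in> M" "s \<le> m"
  shows "partial v s f x = hpoly k (shift_coeffs s a) x"
  using has_vector_derivative_hpoly[OF assms(2,3), of k a] has_vector_derivative_cong_M[OF assms]
  by (blast intro: partial_eqI)

lemma hpoly_0: "hpoly 0 a x = a (\<lambda>_. 0)"
  by (simp add: hpoly_def multi_indices_zero monomial_def)

lemma C1_on_homogeneous_polynomial_map:
  assumes "homogeneous_polynomial_map v m k f" shows "C1_on v m M f"
proof -
  obtain a where a: "\<forall>x\<in>M. f x = hpoly k a x"
    using assms homogeneous_polynomial_map_iff by blast
  obtain b where der: "\<And>s x. s \<le> m \<Longrightarrow> x \<in> M \<Longrightarrow>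
      ((\<lambda>\<epsilon>. f (x + \<epsilon> *\<^sub>R v s)) has_vector_derivative hpoly (k - 1) (b s) x) (at 0)"
  proof (cases k)
    case 0
    \<comment> \<open>the truncated degree \<open>k - 1\<close> is \<open>0\<close>; the derivative is the zero polynomial\<close>
    have "((\<lambda>\<epsilon>. f (x + \<epsilon> *\<^sub>R v s)) has_vector_derivative hpoly 0 (\<lambda>_. 0) x) (at 0)"
      if "s \<le> m" "x \<in> M" for s x
      using has_vector_derivative_cong_M[OF a that(2,1)] 0 by (simp add: hpoly_0)
    then show thesis using that[of "\<lambda>_ _. 0"] 0 by simp
  next
    case (Suc j)
    then show thesis
      using that[of "\<lambda>s. shift_coeffs s a"] has_vector_derivative_cong_M[OF a]
        has_vector_derivative_hpoly by simp
  qed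
  then have "continuous_on M (partial v s f)" if "s \<le> m" for s
    using that partial_eqI[OF der] continuous_on_hpoly[of "k - 1" "b s"]
    by (simp cong: continuous_on_cong)
  then show ?thesis
    unfolding C1_on_def using tendsto_diff_quot der by blast
qed

text \<open>
  Each derivative moves the multi-index of a coefficient and multiplies it by one factor. In the
  closed form, with \<open>g\<close> counting the derivatives taken so far, the factor at \<open>\<alpha>\<close> is \<open>(\<alpha> + g)! / \<alpha>!\<close>; keeping
  \<open>g\<close> as a parameter lets the lemma be iterated over the directions.
\<close>

lemma funpow_partial_hpoly:
  assumes "s \<le> m"
    and "\<forall>x\<in>M. f x = hpoly (l + n) (\<lambda>\<alpha>. (\<Prod>i\<le>m. fact (\<alpha> i + g i) / fact (\<alpha> i)) *\<^sub>R a (\<lambda>i. \<alpha> i + g i)) x"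
  shows "\<forall>x\<in>M. (partial v s ^^ n) f x =
    hpoly l (\<lambda>\<alpha>. (\<Prod>i\<le>m. fact (\<alpha> i + (g(s := g s + n)) i) / fact (\<alpha> i)) *\<^sub>R
      a (\<lambda>i. \<alpha> i + (g(s := g s + n)) i)) x"
  using assms(2)
proof (induction n arbitrary: l)
  case 0
  then show ?case by simp
next
  case (Suc n)
  define G where "G j \<alpha> = (\<Prod>i\<le>m. fact (\<alpha> i + (g(s := g s + j)) i) / fact (\<alpha> i)) *\<^sub>R
      a (\<lambda>i. \<alpha> i + (g(s := g s + j)) i)" for j \<alpha>
  have IH: "\<forall>x\<in>M. (partial v s ^^ n) f x = hpoly (Suc l) (G n) x"
    using Suc.IH[of "Suc l"] Suc.prems by (simp add: G_def[abs_def])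
  have "shift_coeffs s (G n) \<alpha> = G (Suc n) \<alpha>" for \<alpha>
  proof -
    have *: "(\<lambda>i. (raise s \<alpha>) i + (g(s := g s + n)) i) = (\<lambda>i. \<alpha> i + (g(s := g s + Suc n)) i)"
      by auto
    have "real (Suc (\<alpha> s)) * (\<Prod>i\<le>m. fact ((raise s \<alpha>) i + (g(s := g s + n)) i) / fact ((raise s \<alpha>) i))
       = (\<Prod>i\<le>m. fact (\<alpha> i + (g(s := g s + Suc n)) i) / fact (\<alpha> i))"
    proof -
      define q :: real where "q = (\<Prod>i\<in>{..m} - {s}. fact (\<alpha> i + g i) / fact (\<alpha> i))"
      have rest: "(\<Prod>i\<in>{..m} - {s}. fact ((\<alpha>(s := a)) i + (g(s := b)) i) / fact ((\<alpha>(s := a)) i)) = q" for a b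
        unfolding q_def by (intro prod.cong) auto
      have split: "(\<Prod>i\<le>m. fact ((\<alpha>(s := a)) i + (g(s := b)) i) / fact ((\<alpha>(s := a)) i))
          = fact (a + b) / fact a * q" for a b
        using assms(1) rest[of a b] by (subst prod.remove[of _ s]) auto
      have "real (Suc (\<alpha> s)) * (fact (Suc (\<alpha> s) + (g s + n)) / fact (Suc (\<alpha> s)) * q) =
          fact (\<alpha> s + (g s + Suc n)) / fact (\<alpha> s) * q"
        by (simp add: fact_Suc del: of_nat_Suc)
      then show ?thesis
        using split[of "Suc (\<alpha> s)" "g s + n"] split[of "\<alpha> s" "g s + Suc n"] by simp
    qed
    then show ?thesis by (simp only: shift_coeffs_def G_def * scaleR_scaleR)
  qed
  then have "shift_coeffs s (G n) = G (Suc n)" by blast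
  then have "\<forall>x\<in>M. (partial v s ^^ Suc n) f x = hpoly l (G (Suc n)) x"
    using partial_hpoly[OF IH] assms(1) by simp
  then show ?case by (simp only: G_def[abs_def])
qed

text \<open>
  After \<open>k\<close> derivatives a polynomial of degree \<open>k\<close> is constant, and by the closed form above this
  constant is \<open>h! a\<^sub>h\<close>. Since the left-hand side depends only on the values on the span, the
  coefficients of a polynomial map are unique.
\<close>

lemma nabla_hpoly:
  assumes "\<forall>x\<in>M. f x = hpoly k a x" "h \<in> multi_indices {..m} k"
  shows "nabla v m h f 0 = (\<Prod>i\<le>m. fact (h i)) *\<^sub>R a h"
proof -
  have gen: "\<forall>x\<in>M. foldr (\<lambda>s. partial v s ^^ h s) xs f x =
    hpoly l (\<lambda>\<alpha>. (\<Prod>i\<le>m. fact (\<alpha> i + (if i \<in> set xs then h i else 0)) / fact (\<alpha> i)) *\<^sub>R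
      a (\<lambda>i. \<alpha> i + (if i \<in> set xs then h i else 0))) x"
    if "distinct xs" "set xs \<subseteq> {..m}" "k = l + sum h (set xs)" for xs l
    using that
  proof (induction xs arbitrary: l)
    case Nil
    then show ?case using assms(1) by simp
  next
    case (Cons s xs)
    have eq: "(\<lambda>i. if i \<in> set xs then h i else 0)(s := (if s \<in> set xs then h s else 0) + h s) =
       (\<lambda>i. if i \<in> set (s # xs) then h i else 0)"
      using Cons.prems(1) by auto
    show ?case
      using funpow_partial_hpoly[of s "foldr (\<lambda>s. partial v s ^^ h s) xs f" l "h s"
            "\<lambda>i. if i \<in> set xs then h i else 0" a, unfolded eq]
        Cons.IH[of "l + h s"] Cons.prems by (simp add: add.assoc)
  qed
  have "set [0..<Suc m] = {..m}" by (auto simp: atLeast0LessThan)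
  then have "nabla v m h f 0 = (\<Prod>i\<le>m. fact (h i)) *\<^sub>R a (\<lambda>i. if i \<le> m then h i else 0)"
    using gen[of "[0..<Suc m]" 0] assms(2) unfolding nabla_def
    by (simp add: hpoly_0 multi_indices_def span_zero del: upt_Suc)
  also have "(\<lambda>i. if i \<le> m then h i else 0) = h"
    using assms(2) by (auto simp: multi_indices_def fun_eq_iff)
  finally show ?thesis .
qed

lemma hpoly_coeffs_unique:
  assumes "\<forall>x\<in>M. hpoly k a x = hpoly k b x" "h \<in> multi_indices {..m} k"
  shows "a h = b h"
proof -
  have "(\<Prod>i\<le>m. fact (h i)) *\<^sub>R a h = (\<Prod>i\<le>m. fact (h i)) *\<^sub>R b h"
    using nabla_hpoly[of "hpoly k a" k a h] nabla_hpoly[OF assms] assms(2) by simp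
  then show ?thesis by (simp add: prod_zero_iff)
qed

section \<open>Uniqueness of monogenic extensions from the hyperplane\<close>

lemma monomial_axis:
  assumes "x \<in> M"
  shows "monomial \<alpha> (x - coord v m 0 x *\<^sub>R v 0) = (if \<alpha> 0 = 0 then monomial \<alpha> x else 0)"
proof -
  have c: "coord v m u (x - coord v m 0 x *\<^sub>R v 0) = (if u = 0 then 0 else coord v m u x)" if "u \<le> m" for u
    using coord_shift[OF assms, of 0 u "- coord v m 0 x"] that by simp
  have "(\<Prod>u\<in>{..m} - {0}. coord v m u (x - coord v m 0 x *\<^sub>R v 0) ^ \<alpha> u)
      = (\<Prod>u\<in>{..m} - {0}. coord v m u x ^ \<alpha> u)"
    by (intro prod.cong) (auto simp: c)
  then show ?thesis by (simp add: monomial_remove[of 0] c)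
qed

lemma dbar_hpoly_Suc:
  assumes "\<forall>x\<in>M. f x = hpoly (Suc k) a x" "x \<in> M"
  shows "dbar v m f x = hpoly k (\<lambda>\<alpha>. \<Sum>s\<le>m. v s * shift_coeffs s a \<alpha>) x"
proof -
  have "dbar v m f x = (\<Sum>s\<le>m. v s * hpoly k (shift_coeffs s a) x)"
    unfolding dbar_def using partial_hpoly[OF assms] by (intro sum.cong) auto
  then show ?thesis
    unfolding hpoly_def by (simp add: scaleR_sum_right sum_distrib_left) (rule sum.swap)
qed

text \<open>
  Composing a polynomial with the projection along \<open>v\<^sub>0\<close> onto the hyperplane discards exactly the
  coefficients with \<open>\<alpha>\<^sub>0 \<noteq> 0\<close>, so the values on the hyperplane determine the others.
\<close>

lemma hpoly_eq_on_hyperplane: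
  assumes "\<And>x. x \<in> M \<Longrightarrow> coord v m 0 x = 0 \<Longrightarrow> hpoly k a x = hpoly k b x"
    and "\<alpha> \<in> multi_indices {..m} k" "\<alpha> 0 = 0"
  shows "a \<alpha> = b \<alpha>"
proof -
  define r where "r c \<beta> = (if \<beta> 0 = 0 then c \<beta> else (0::'a))" for c and \<beta> :: "nat \<Rightarrow> nat"
  have r: "hpoly k (r c) x = hpoly k c (x - coord v m 0 x *\<^sub>R v 0)" if "x \<in> M" for c x
    unfolding hpoly_def by (intro sum.cong) (auto simp: r_def monomial_axis[OF that])
  have "hpoly k (r a) x = hpoly k (r b) x" if x: "x \<in> M" for x
  proof -
    have "x - coord v m 0 x *\<^sub>R v 0 \<in> M"
      using x shift_in_M[OF x, of 0 "- coord v m 0 x"] by simp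
    moreover have "coord v m 0 (x - coord v m 0 x *\<^sub>R v 0) = 0"
      using coord_shift[OF x, of 0 0 "- coord v m 0 x"] by simp
    ultimately show ?thesis using assms(1) r[OF x] by simp
  qed
  then have "r a \<alpha> = r b \<alpha>" using hpoly_coeffs_unique assms(2) by blast
  then show ?thesis using assms(3) by (simp add: r_def)
qed

text \<open>
  Cauchy-Kovalevskaya uniqueness for polynomials. As \<open>v\<^sub>0 = 1\<close>, the equation says
  \<open>\<partial>\<^sub>0 f = - (\<Sum>\<^sub>s\<^sub>\<ge>\<^sub>1 v\<^sub>s \<partial>\<^sub>s f)\<close>. Comparing coefficients, it expresses \<open>a\<^sub>\<alpha>\<close> with \<open>\<alpha>\<^sub>0 = j + 1\<close> through
  coefficients whose zeroth index is \<open>j\<close>, and those with \<open>\<alpha>\<^sub>0 = 0\<close> are read off on the hyperplane.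
\<close>

lemma monogenic_polynomials_eqI:
  assumes f: "f \<in> monogenic_polynomials M v m k" and g: "g \<in> monogenic_polynomials M v m k"
    and hyp: "\<And>x. x \<in> M \<Longrightarrow> coord v m 0 x = 0 \<Longrightarrow> f x = g x"
    and x: "x \<in> M"
  shows "f x = g x"
proof -
  obtain a b where a: "\<forall>x\<in>M. f x = hpoly k a x" and b: "\<forall>x\<in>M. g x = hpoly k b x"
    using f g homogeneous_polynomial_map_iff by (auto simp: monogenic_polynomials_def)
  have "a \<alpha> = b \<alpha>" if "\<alpha> \<in> multi_indices {..m} k" "\<alpha> 0 = j" for \<alpha> j
    using that
  proof (induction j arbitrary: \<alpha>)
    case 0
    have "hpoly k a y = hpoly k b y" if "y \<in> M" "coord v m 0 y = 0" for y
      using hyp[OF that] a b that(1) by simp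
    from hpoly_eq_on_hyperplane[OF this 0] show ?case by blast
  next
    case (Suc j)
    define \<beta> where "\<beta> = \<alpha>(0 := j)"
    have \<alpha>: "\<alpha> = raise 0 \<beta>" using Suc.prems(2) by (auto simp: \<beta>_def)
    obtain l where k: "k = Suc l" and \<beta>: "\<beta> \<in> multi_indices {..m} l"
      using Suc.prems sum_raise[of "{..m}" 0 \<beta>] \<alpha> by (auto simp: multi_indices_def)
    have "hpoly l (\<lambda>\<alpha>. \<Sum>s\<le>m. v s * shift_coeffs s a \<alpha>) y =
        hpoly l (\<lambda>\<alpha>. \<Sum>s\<le>m. v s * shift_coeffs s b \<alpha>) y" if "y \<in> M" for y
    proof -
      have "dbar v m f y = 0" "dbar v m g y = 0"
        using f g that by (auto simp: monogenic_polynomials_def left_monogenic_def)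
      then show ?thesis
        using dbar_hpoly_Suc[of f l a y] dbar_hpoly_Suc[of g l b y] a b k that by simp
    qed
    then have "(\<Sum>s\<le>m. v s * shift_coeffs s a \<beta>) = (\<Sum>s\<le>m. v s * shift_coeffs s b \<beta>)"
      using hpoly_coeffs_unique[OF _ \<beta>] by blast
    moreover have "shift_coeffs s a \<beta> = shift_coeffs s b \<beta>" if "s \<le> m" "s \<noteq> 0" for s
    proof -
      have "raise s \<beta> \<in> multi_indices {..m} k"
        using raise_multi_indices[OF _ _ \<beta>] that k by simp
      moreover have "raise s \<beta> 0 = j" using that by (simp add: \<beta>_def)
      ultimately have "a (raise s \<beta>) = b (raise s \<beta>)" by (rule Suc.IH)
      then show ?thesis by (simp only: shift_coeffs_def)
    qed
    ultimately have "shift_coeffs 0 a \<beta> = shift_coeffs 0 b \<beta>"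
      by (simp add: sum.remove[of "{..m}" 0] v0)
    then have "a (raise 0 \<beta>) = b (raise 0 \<beta>)" by (simp add: shift_coeffs_def del: of_nat_Suc)
    then show ?case by (simp only: \<alpha>)
  qed
  then show ?thesis using a b x by (simp add: hpoly_def)
qed

end

section \<open>Algebra of the Fueter polynomials\<close>

abbreviation fueter :: "(nat \<Rightarrow> 'a::real_algebra_1) \<Rightarrow> nat \<Rightarrow> (nat \<Rightarrow> nat) \<Rightarrow> 'a \<Rightarrow> 'a" where
  "fueter v m \<kappa> \<equiv> fueter_poly v m (\<lambda>s. int (\<kappa> s))"

lemma fueter_degree_0: "sum \<kappa> {1..m} = 0 \<Longrightarrow> fueter v m \<kappa> x = 1"
  by (subst fueter_poly.simps) simp

lemma sum_lower:
  assumes "finite S" "s \<in> S" "0 < \<kappa> s" shows "Suc (sum (lower s \<kappa>) S) = sum \<kappa> S"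
  using sum_raise[OF assms(1,2), of "lower s \<kappa>"] assms(3) by simp

text \<open>
  Multiplying by \<open>\<bar>\<kappa>\<bar>\<close> removes all case distinctions: truncated subtraction in \<open>lower s \<kappa>\<close> is harmless
  because the factor \<open>\<kappa> s\<close> vanishes where it matters.
\<close>

lemma fueter_recursion:
  "real (sum \<kappa> {1..m}) *\<^sub>R fueter v m \<kappa> x =
    (\<Sum>s=1..m. real (\<kappa> s) *\<^sub>R (fueter v m (lower s \<kappa>) x * fueter_variable v m s x))"
proof (cases "sum \<kappa> {1..m} = 0")
  case True
  then show ?thesis by simp
next
  case False
  have "fueter v m \<kappa> x = inverse (real (sum \<kappa> {1..m})) *\<^sub>R
     (\<Sum>s\<in>{1..m}. of_int (int (\<kappa> s)) * fueter_poly v m ((\<lambda>s. int (\<kappa> s))(s := int (\<kappa> s) - 1)) x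
        * fueter_variable v m s x)"
    using False by (subst fueter_poly.simps) simp
  also have "(\<Sum>s\<in>{1..m}. of_int (int (\<kappa> s)) * fueter_poly v m ((\<lambda>s. int (\<kappa> s))(s := int (\<kappa> s) - 1)) x
        * fueter_variable v m s x) =
     (\<Sum>s=1..m. real (\<kappa> s) *\<^sub>R (fueter v m (lower s \<kappa>) x * fueter_variable v m s x))"
  proof (intro sum.cong refl)
    fix s
    have "(\<lambda>s. int (\<kappa> s))(s := int (\<kappa> s) - 1) = (\<lambda>u. int (lower s \<kappa> u))" if "0 < \<kappa> s"
      using that by (auto simp: fun_eq_iff)
    then show "of_int (int (\<kappa> s)) * fueter_poly v m ((\<lambda>s. int (\<kappa> s))(s := int (\<kappa> s) - 1)) x
        * fueter_variable v m s x = real (\<kappa> s) *\<^sub>R (fueter v m (lower s \<kappa>) x * fueter_variable v m s x)"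
      by (cases "\<kappa> s = 0") (auto simp: scaleR_conv_of_real mult.assoc)
  qed
  finally have eq: "fueter v m \<kappa> x = inverse (real (sum \<kappa> {1..m})) *\<^sub>R
    (\<Sum>s=1..m. real (\<kappa> s) *\<^sub>R (fueter v m (lower s \<kappa>) x * fueter_variable v m s x))" .
  show ?thesis
    using False by (simp only: eq scaleR_scaleR right_inverse of_nat_eq_0_iff scaleR_one not_False_eq_True)
qed

lemma lower_commute: "lower s (lower u \<kappa>) = lower u (lower s \<kappa>)"
  by (auto simp: fun_eq_iff)

text \<open>
  Applying the recursion twice produces the weights \<open>\<kappa>\<^sub>s (\<kappa> - \<epsilon>\<^sub>s)\<^sub>u\<close>. Their symmetry in \<open>s\<close> and \<open>u\<close> drives
  every double sum argument below.
\<close>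

lemma lower_coeff_symmetric: "\<kappa> s * lower s \<kappa> u = \<kappa> u * lower u \<kappa> s"
  by (cases "s = u") auto

lemma sum_sum_antisymmetric:
  fixes f :: "'i \<Rightarrow> 'i \<Rightarrow> 'b::real_vector"
  assumes "\<And>s u. s \<in> S \<Longrightarrow> u \<in> S \<Longrightarrow> f s u = - f u s"
  shows "(\<Sum>s\<in>S. \<Sum>u\<in>S. f s u) = 0"
proof -
  have "(\<Sum>s\<in>S. \<Sum>u\<in>S. f s u) = (\<Sum>s\<in>S. \<Sum>u\<in>S. - f u s)"
    by (intro sum.cong refl assms)
  also have "\<dots> = - (\<Sum>s\<in>S. \<Sum>u\<in>S. f s u)"
    by (subst sum.swap) (simp add: sum_negf)
  finally show ?thesis by (simp add: eq_neg_iff_add_eq_0 flip: scaleR_2)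
qed

text \<open>
  The second application of the recursion, inside a weighted sum of Fueter polynomials of degree \<open>n\<close>.
  The maps \<open>T s\<close> will be the left and the right multiplication by \<open>v\<^sub>s\<close>.
\<close>

lemma fueter_weighted_recursion:
  fixes T :: "nat \<Rightarrow> 'a::real_algebra_1 \<Rightarrow> 'a"
  assumes T: "\<And>s. s \<in> {1..m} \<Longrightarrow> linear (T s)" and n: "sum \<kappa> {1..m} = Suc n"
  shows "real n *\<^sub>R (\<Sum>s=1..m. real (\<kappa> s) *\<^sub>R T s (fueter v m (lower s \<kappa>) x)) =
    (\<Sum>s=1..m. \<Sum>u=1..m. real (\<kappa> s * lower s \<kappa> u) *\<^sub>R
       T s (fueter v m (lower u (lower s \<kappa>)) x * fueter_variable v m u x))"
proof -
  have "real n *\<^sub>R (real (\<kappa> s) *\<^sub>R T s (fueter v m (lower s \<kappa>) x)) =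
    (\<Sum>u=1..m. real (\<kappa> s * lower s \<kappa> u) *\<^sub>R
       T s (fueter v m (lower u (lower s \<kappa>)) x * fueter_variable v m u x))"
    if s: "s \<in> {1..m}" for s
  proof (cases "\<kappa> s = 0")
    case False
    then have "sum (lower s \<kappa>) {1..m} = n"
      using sum_lower[of "{1..m}" s \<kappa>] s n by simp
    then have "real n *\<^sub>R fueter v m (lower s \<kappa>) x = (\<Sum>u=1..m. real (lower s \<kappa> u) *\<^sub>R
        (fueter v m (lower u (lower s \<kappa>)) x * fueter_variable v m u x))"
      using fueter_recursion[of "lower s \<kappa>" m v x] by (simp only:)
    from arg_cong[OF this, of "\<lambda>y. real (\<kappa> s) *\<^sub>R T s y"] show ?thesis
      by (simp add: linear_sum[OF T[OF s]] linear_cmul[OF T[OF s]] scaleR_sum_right mult.commute mult.left_commute)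
  qed simp
  then show ?thesis by (simp add: scaleR_sum_right)
qed

text \<open>
  The individual products \<open>v\<^sub>s P\<close> and \<open>P v\<^sub>s\<close> differ, but the symmetrised sums agree. After a second
  application of the recursion, induction moves the left factors \<open>v\<^sub>s\<close> past all but the last Fueter
  variable. What remains is a sum over \<open>s, u\<close> of terms symmetric in \<open>s\<close> and \<open>u\<close>, each multiplied from
  the right by \<open>v\<^sub>u \<zeta>\<^sub>s - \<zeta>\<^sub>u v\<^sub>s\<close>. Since \<open>\<zeta>\<^sub>s = x\<^sub>s - x\<^sub>0 v\<^sub>s\<close>, the products \<open>x\<^sub>0 v\<^sub>u v\<^sub>s\<close> cancel and this factor
  is \<open>x\<^sub>s v\<^sub>u - x\<^sub>u v\<^sub>s\<close>, which is antisymmetric.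
\<close>

lemma fueter_commutation:
  fixes v :: "nat \<Rightarrow> 'a::real_algebra_1"
  shows "(\<Sum>s=1..m. real (\<kappa> s) *\<^sub>R (v s * fueter v m (lower s \<kappa>) x)) =
   (\<Sum>s=1..m. real (\<kappa> s) *\<^sub>R (fueter v m (lower s \<kappa>) x * v s))"
proof (induction "sum \<kappa> {1..m}" arbitrary: \<kappa>)
  case 0
  then show ?case by simp
next
  case (Suc n)
  show ?case
  proof (cases "n = 0")
    case True
    \<comment> \<open>dividing by \<open>n\<close> is impossible here, but the polynomials in the sums are all \<open>1\<close>\<close>
    have "v s * fueter v m (lower s \<kappa>) x = fueter v m (lower s \<kappa>) x * v s"
      if "s \<in> {1..m}" "0 < \<kappa> s" for s
      using sum_lower[of "{1..m}" s \<kappa>] that Suc.hyps(2) True by (simp add: fueter_degree_0)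
    then show ?thesis by (intro sum.cong refl) auto
  next
    case False
    let ?F = "\<lambda>s u. fueter v m (lower u (lower s \<kappa>)) x"
    let ?z = "\<lambda>u. fueter_variable v m u x"
    let ?c = "\<lambda>s u. real (\<kappa> s * lower s \<kappa> u)"
    have c: "?c s u = ?c u s" for s u using lower_coeff_symmetric[of \<kappa> s u] by (simp only:)
    have F: "?F s u = ?F u s" for s u using lower_commute[where u = s and s = u and \<kappa> = \<kappa>] by (simp only:)
    have "real n *\<^sub>R (\<Sum>s=1..m. real (\<kappa> s) *\<^sub>R (v s * fueter v m (lower s \<kappa>) x)) =
        (\<Sum>s=1..m. \<Sum>u=1..m. ?c s u *\<^sub>R (v s * (?F s u * ?z u)))"
      by (rule fueter_weighted_recursion) (use Suc.hyps(2) in \<open>auto simp: linear_iff algebra_simps\<close>)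
    also have "\<dots> = (\<Sum>u=1..m. \<Sum>s=1..m. ?c u s *\<^sub>R (v s * (?F u s * ?z u)))"
      by (subst sum.swap) (intro sum.cong refl arg_cong2[of _ _ _ _ scaleR] arg_cong2[of _ _ _ _ times] c F)
    also have "\<dots> = (\<Sum>u=1..m. real (\<kappa> u) *\<^sub>R ((\<Sum>s=1..m. real (lower u \<kappa> s) *\<^sub>R (v s * ?F u s)) * ?z u))"
      by (simp add: sum_distrib_right scaleR_sum_right mult.assoc)
    also have "\<dots> = (\<Sum>u=1..m. real (\<kappa> u) *\<^sub>R ((\<Sum>s=1..m. real (lower u \<kappa> s) *\<^sub>R (?F u s * v s)) * ?z u))"
    proof (intro sum.cong refl)
      fix u assume u: "u \<in> {1..m}"
      show "real (\<kappa> u) *\<^sub>R ((\<Sum>s=1..m. real (lower u \<kappa> s) *\<^sub>R (v s * ?F u s)) * ?z u) =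
        real (\<kappa> u) *\<^sub>R ((\<Sum>s=1..m. real (lower u \<kappa> s) *\<^sub>R (?F u s * v s)) * ?z u)"
      proof (cases "\<kappa> u = 0")
        case False
        then have "n = sum (lower u \<kappa>) {1..m}"
          using sum_lower[of "{1..m}" u \<kappa>] u Suc.hyps(2) by simp
        from Suc.hyps(1)[OF this] show ?thesis by (simp only:)
      qed simp
    qed
    also have "\<dots> = (\<Sum>s=1..m. \<Sum>u=1..m. ?c s u *\<^sub>R (?F s u * v u * ?z s))"
      by (simp add: sum_distrib_right scaleR_sum_right)
    finally have L: "real n *\<^sub>R (\<Sum>s=1..m. real (\<kappa> s) *\<^sub>R (v s * fueter v m (lower s \<kappa>) x)) =
      (\<Sum>s=1..m. \<Sum>u=1..m. ?c s u *\<^sub>R (?F s u * v u * ?z s))" .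
    have R: "real n *\<^sub>R (\<Sum>s=1..m. real (\<kappa> s) *\<^sub>R (fueter v m (lower s \<kappa>) x * v s)) =
        (\<Sum>s=1..m. \<Sum>u=1..m. ?c s u *\<^sub>R ((?F s u * ?z u) * v s))"
      by (rule fueter_weighted_recursion[of m "\<lambda>s y. y * v s"])
        (use Suc.hyps(2) in \<open>auto simp: linear_iff algebra_simps\<close>)
    have "(\<Sum>s=1..m. \<Sum>u=1..m. ?c s u *\<^sub>R (?F s u * (v u * ?z s - ?z u * v s))) = 0"
    proof (rule sum_sum_antisymmetric)
      fix s u
      have "v u * ?z s - ?z u * v s = - (v s * ?z u - ?z s * v u)"
        by (simp add: fueter_variable_def algebra_simps of_real_def)
      then show "?c s u *\<^sub>R (?F s u * (v u * ?z s - ?z u * v s)) =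
          - (?c u s *\<^sub>R (?F u s * (v s * ?z u - ?z s * v u)))"
        by (simp only: c[of s u] F[of s u] mult_minus_right scaleR_minus_right)
    qed
    then have "real n *\<^sub>R (\<Sum>s=1..m. real (\<kappa> s) *\<^sub>R (v s * fueter v m (lower s \<kappa>) x)) =
      real n *\<^sub>R (\<Sum>s=1..m. real (\<kappa> s) *\<^sub>R (fueter v m (lower s \<kappa>) x * v s))"
      unfolding L R by (simp only: right_diff_distrib scaleR_diff_right sum_subtractf mult.assoc eq_iff_diff_eq_0[symmetric])
    then show ?thesis using False by simp
  qed
qed

context coordinate_frame
begin

section \<open>Fueter polynomials as polynomial maps, and their restriction to the hyperplane\<close>

lemma homogeneous_polynomial_map_right_mult:
  assumes "homogeneous_polynomial_map v m k f"
  shows "homogeneous_polynomial_map v m k (\<lambda>x. f x * c)"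
proof -
  obtain a where "\<forall>x\<in>M. f x = hpoly k a x"
    using assms homogeneous_polynomial_map_iff by blast
  then have "\<forall>x\<in>M. f x * c = hpoly k (\<lambda>\<alpha>. a \<alpha> * c) x"
    by (simp add: hpoly_def sum_distrib_right)
  then show ?thesis using homogeneous_polynomial_map_iff by blast
qed

lemma homogeneous_polynomial_map_scaleR:
  assumes "homogeneous_polynomial_map v m k f"
  shows "homogeneous_polynomial_map v m k (\<lambda>x. r *\<^sub>R f x)"
  using homogeneous_polynomial_map_right_mult[OF assms, of "of_real r"]
  by (simp add: of_real_def)

lemma homogeneous_polynomial_map_diff:
  assumes "homogeneous_polynomial_map v m k f" "homogeneous_polynomial_map v m k g"
  shows "homogeneous_polynomial_map v m k (\<lambda>x. f x - g x)"
proof -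
  obtain a b where "\<forall>x\<in>M. f x = hpoly k a x" "\<forall>x\<in>M. g x = hpoly k b x"
    using assms homogeneous_polynomial_map_iff by blast
  then have "\<forall>x\<in>M. f x - g x = hpoly k (\<lambda>\<alpha>. a \<alpha> - b \<alpha>) x"
    by (simp add: hpoly_def sum_subtractf scaleR_diff_right)
  then show ?thesis using homogeneous_polynomial_map_iff by blast
qed

lemma homogeneous_polynomial_map_sum:
  assumes "\<And>i. i \<in> I \<Longrightarrow> homogeneous_polynomial_map v m k (f i)"
  shows "homogeneous_polynomial_map v m k (\<lambda>x. \<Sum>i\<in>I. f i x)"
proof -
  have "\<forall>i\<in>I. \<exists>a. \<forall>x\<in>M. f i x = hpoly k a x"
    using assms homogeneous_polynomial_map_iff by blast
  then obtain a where "\<forall>i\<in>I. \<forall>x\<in>M. f i x = hpoly k (a i) x" by metis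
  then have "(\<Sum>i\<in>I. f i x) = hpoly k (\<lambda>\<alpha>. \<Sum>i\<in>I. a i \<alpha>) x" if "x \<in> M" for x
    using that sum.swap[of "\<lambda>i \<alpha>. monomial \<alpha> x *\<^sub>R a i \<alpha>" "multi_indices {..m} k" I]
    by (simp add: hpoly_def scaleR_sum_right)
  then show ?thesis using homogeneous_polynomial_map_iff by blast
qed

lemma homogeneous_polynomial_map_coord_mult:
  assumes "homogeneous_polynomial_map v m k f" "s \<le> m"
  shows "homogeneous_polynomial_map v m (Suc k) (\<lambda>x. coord v m s x *\<^sub>R f x)"
proof -
  obtain a where a: "\<forall>x\<in>M. f x = hpoly k a x"
    using assms homogeneous_polynomial_map_iff by blast
  define b where "b \<alpha> = (if \<alpha> s = 0 then 0 else a (lower s \<alpha>))" for \<alpha>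
  have "hpoly (Suc k) b x = coord v m s x *\<^sub>R hpoly k a x" for x
    unfolding hpoly_def using assms(2)
    by (subst sum_multi_indices_Suc[of _ s]) (auto simp: b_def monomial_raise scaleR_sum_right)
  then have "\<forall>x\<in>M. coord v m s x *\<^sub>R f x = hpoly (Suc k) b x" using a by simp
  then show ?thesis using homogeneous_polynomial_map_iff by blast
qed

lemma homogeneous_polynomial_map_fueter:
  "sum \<kappa> {1..m} = n \<Longrightarrow> homogeneous_polynomial_map v m n (fueter v m \<kappa>)"
proof (induction n arbitrary: \<kappa>)
  case 0
  have "\<forall>x\<in>M. fueter v m \<kappa> x = hpoly 0 (\<lambda>_. 1) x"
    using 0 by (simp add: hpoly_0 fueter_degree_0)
  then show ?case using homogeneous_polynomial_map_iff by blast
next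
  case (Suc n)
  define g where "g s x = real (\<kappa> s) *\<^sub>R (fueter v m (lower s \<kappa>) x * fueter_variable v m s x)" for s x
  have "homogeneous_polynomial_map v m (Suc n) (g s)" if s: "s \<in> {1..m}" for s
  proof (cases "\<kappa> s = 0")
    case True
    have "\<forall>x\<in>M. g s x = hpoly (Suc n) (\<lambda>_. 0) x" using True by (simp add: g_def hpoly_def)
    then show ?thesis using homogeneous_polynomial_map_iff by blast
  next
    case False
    then have h: "homogeneous_polynomial_map v m n (fueter v m (lower s \<kappa>))"
      using Suc.IH[of "lower s \<kappa>"] Suc.prems sum_lower[of "{1..m}" s \<kappa>] s by simp
    have "homogeneous_polynomial_map v m (Suc n) (\<lambda>x. real (\<kappa> s) *\<^sub>R
        (coord v m s x *\<^sub>R fueter v m (lower s \<kappa>) x - coord v m 0 x *\<^sub>R fueter v m (lower s \<kappa>) x * v s))"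
      using s h
      by (intro homogeneous_polynomial_map_scaleR homogeneous_polynomial_map_diff
          homogeneous_polynomial_map_coord_mult homogeneous_polynomial_map_right_mult) auto
    then show ?thesis
      by (simp add: g_def[abs_def] fueter_variable_def right_diff_distrib of_real_def)
  qed
  then have "homogeneous_polynomial_map v m (Suc n) (\<lambda>x. inverse (real (Suc n)) *\<^sub>R (\<Sum>s=1..m. g s x))"
    by (intro homogeneous_polynomial_map_scaleR homogeneous_polynomial_map_sum)
  also have "(\<lambda>x. inverse (real (Suc n)) *\<^sub>R (\<Sum>s=1..m. g s x)) = fueter v m \<kappa>"
  proof
    fix x
    show "inverse (real (Suc n)) *\<^sub>R (\<Sum>s=1..m. g s x) = fueter v m \<kappa> x"
      unfolding g_def fueter_recursion[symmetric] Suc.prems by (simp del: of_nat_Suc)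
  qed
  finally show ?case .
qed

text \<open>
  For \<open>x\<^sub>0 = 0\<close> the Fueter variables are the real numbers \<open>x\<^sub>s\<close>, so the recursion produces an ordinary
  monomial.
\<close>

lemma fueter_on_hyperplane:
  assumes "coord v m 0 x = 0"
  shows "fueter v m \<kappa> x = of_real (\<Prod>s=1..m. coord v m s x ^ \<kappa> s)"
proof (induction "sum \<kappa> {1..m}" arbitrary: \<kappa>)
  case 0
  then show ?case by (simp add: fueter_degree_0)
next
  case (Suc n)
  define p where "p \<mu> = (\<Prod>s=1..m. coord v m s x ^ \<mu> s)" for \<mu> :: "nat \<Rightarrow> nat"
  have "real (sum \<kappa> {1..m}) *\<^sub>R fueter v m \<kappa> x = (\<Sum>s=1..m. real (\<kappa> s) *\<^sub>R of_real (p \<kappa>))"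
    unfolding fueter_recursion
  proof (intro sum.cong refl)
    fix s assume s: "s \<in> {1..m}"
    show "real (\<kappa> s) *\<^sub>R (fueter v m (lower s \<kappa>) x * fueter_variable v m s x) = real (\<kappa> s) *\<^sub>R of_real (p \<kappa>)"
    proof (cases "\<kappa> s = 0")
      case False
      then have "n = sum (lower s \<kappa>) {1..m}"
        using Suc.hyps(2) sum_lower[of "{1..m}" s \<kappa>] s by simp
      then have "fueter v m (lower s \<kappa>) x = of_real (p (lower s \<kappa>))"
        unfolding p_def by (rule Suc.hyps(1))
      moreover have "p \<kappa> = p (lower s \<kappa>) * coord v m s x"
      proof -
        have "(\<Prod>u\<in>{1..m} - {s}. coord v m u x ^ lower s \<kappa> u) = (\<Prod>u\<in>{1..m} - {s}. coord v m u x ^ \<kappa> u)"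
          by (intro prod.cong) auto
        moreover have "coord v m s x ^ \<kappa> s = coord v m s x ^ (\<kappa> s - 1) * coord v m s x"
          using False by (metis not_gr0 power_minus_mult)
        ultimately show ?thesis
          unfolding p_def using s by (simp add: prod.remove[of _ s])
      qed
      ultimately show ?thesis by (simp add: fueter_variable_def assms)
    qed simp
  qed
  also have "\<dots> = real (sum \<kappa> {1..m}) *\<^sub>R of_real (p \<kappa>)"
    by (simp only: scaleR_sum_left[symmetric] of_nat_sum)
  finally have "real (sum \<kappa> {1..m}) *\<^sub>R fueter v m \<kappa> x = real (sum \<kappa> {1..m}) *\<^sub>R of_real (p \<kappa>)" .
  moreover have "real (sum \<kappa> {1..m}) \<noteq> 0"
    using Suc.hyps(2) by (metis of_nat_eq_0_iff nat.distinct(1))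
  ultimately show ?case by (simp only: scaleR_cancel_left p_def simp_thms)
qed

section \<open>Derivatives of the Fueter polynomials\<close>

lemma fueter_variable_shift:
  assumes "x \<in> M" "s \<le> m" "u \<in> {1..m}"
  shows "fueter_variable v m u (x + r *\<^sub>R v s) = fueter_variable v m u x +
    r *\<^sub>R (if s = 0 then - v u else if s = u then 1 else 0)"
  using assms by (auto simp: fueter_variable_def coord_shift of_real_def algebra_simps)

text \<open>
  The induction step for both derivative formulas: differentiating the recursion by the product
  rule reduces each formula to the identity \<open>eq\<close>, in which \<open>D\<close> is the formula in degree \<open>n\<close>.
\<close>

lemma has_vector_derivative_fueter_step:
  fixes D :: "(nat \<Rightarrow> nat) \<Rightarrow> 'a"
  assumes x: "x \<in> M" and s: "s \<le> m" and n: "sum \<kappa> {1..m} = Suc n"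
    and D: "\<And>u. u \<in> {1..m} \<Longrightarrow> 0 < \<kappa> u \<Longrightarrow>
      ((\<lambda>\<epsilon>. fueter v m (lower u \<kappa>) (x + \<epsilon> *\<^sub>R v s)) has_vector_derivative D (lower u \<kappa>)) (at 0)"
    and eq: "(\<Sum>u=1..m. real (\<kappa> u) *\<^sub>R (fueter v m (lower u \<kappa>) x * (if s = 0 then - v u else if s = u then 1 else 0)
       + D (lower u \<kappa>) * fueter_variable v m u x)) = real (Suc n) *\<^sub>R L"
  shows "((\<lambda>\<epsilon>. fueter v m \<kappa> (x + \<epsilon> *\<^sub>R v s)) has_vector_derivative L) (at 0)"
proof -
  let ?d = "\<lambda>u. if s = 0 then - v u else if s = u then 1 else 0"
  have var: "((\<lambda>\<epsilon>. fueter_variable v m u (x + \<epsilon> *\<^sub>R v s)) has_vector_derivative ?d u) (at 0)"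
    if "u \<in> {1..m}" for u
    unfolding fueter_variable_shift[OF x s that]
    by (auto intro!: derivative_eq_intros)
  have "((\<lambda>\<epsilon>. \<Sum>u=1..m. real (\<kappa> u) *\<^sub>R (fueter v m (lower u \<kappa>) (x + \<epsilon> *\<^sub>R v s) * fueter_variable v m u (x + \<epsilon> *\<^sub>R v s)))
    has_vector_derivative
      (\<Sum>u=1..m. real (\<kappa> u) *\<^sub>R (fueter v m (lower u \<kappa>) x * ?d u + D (lower u \<kappa>) * fueter_variable v m u x))) (at 0)"
  proof (intro has_vector_derivative_sum)
    fix u assume u: "u \<in> {1..m}"
    show "((\<lambda>\<epsilon>. real (\<kappa> u) *\<^sub>R (fueter v m (lower u \<kappa>) (x + \<epsilon> *\<^sub>R v s) * fueter_variable v m u (x + \<epsilon> *\<^sub>R v s)))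
      has_vector_derivative real (\<kappa> u) *\<^sub>R (fueter v m (lower u \<kappa>) x * ?d u + D (lower u \<kappa>) * fueter_variable v m u x)) (at 0)"
    proof (cases "\<kappa> u = 0")
      case False
      then show ?thesis
        using bounded_bilinear.has_vector_derivative[OF bounded_bilinear_mult_euclidean D[OF u] var[OF u]]
        by (intro bounded_linear.has_vector_derivative[OF bounded_linear_scaleR_right]) simp
    qed simp
  qed
  then have "((\<lambda>\<epsilon>. real (Suc n) *\<^sub>R fueter v m \<kappa> (x + \<epsilon> *\<^sub>R v s)) has_vector_derivative real (Suc n) *\<^sub>R L) (at 0)"
    unfolding eq fueter_recursion[symmetric] n .
  from bounded_linear.has_vector_derivative[OF bounded_linear_scaleR_right this, of "inverse (real (Suc n))"]
  show ?thesis by (simp del: of_nat_Suc)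
qed

text \<open>
  With \<open>\<bar>\<kappa>\<bar> = n + 1\<close>, the derivatives of the polynomial factors recombine by the recursion for
  \<open>\<kappa> - \<epsilon>\<^sub>s\<close> to \<open>n\<close> copies of the claimed value, and the derivative of \<open>\<zeta>\<^sub>s\<close> contributes one more.
\<close>

lemma has_vector_derivative_fueter:
  assumes x: "x \<in> M" and s: "s \<in> {1..m}"
  shows "((\<lambda>\<epsilon>. fueter v m \<kappa> (x + \<epsilon> *\<^sub>R v s)) has_vector_derivative real (\<kappa> s) *\<^sub>R fueter v m (lower s \<kappa>) x) (at 0)"
proof (induction "sum \<kappa> {1..m}" arbitrary: \<kappa>)
  case 0
  then show ?case using s by (simp add: fueter_degree_0)
next
  case (Suc n)
  show ?case
  proof (rule has_vector_derivative_fueter_step[where D = "\<lambda>\<kappa>. real (\<kappa> s) *\<^sub>R fueter v m (lower s \<kappa>) x", OF x])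
    show "s \<le> m" using s by simp
    show "sum \<kappa> {1..m} = Suc n" using Suc.hyps(2) by simp
    show "((\<lambda>\<epsilon>. fueter v m (lower u \<kappa>) (x + \<epsilon> *\<^sub>R v s)) has_vector_derivative
        real (lower u \<kappa> s) *\<^sub>R fueter v m (lower s (lower u \<kappa>)) x) (at 0)" if "u \<in> {1..m}" "0 < \<kappa> u" for u
      by (rule Suc.hyps(1)) (use sum_lower[of "{1..m}" u \<kappa>] that Suc.hyps(2) in simp)
    have "(\<Sum>u=1..m. real (\<kappa> u) *\<^sub>R ((real (lower u \<kappa> s) *\<^sub>R fueter v m (lower s (lower u \<kappa>)) x) * fueter_variable v m u x))
       = real (\<kappa> s) *\<^sub>R (\<Sum>u=1..m. real (lower s \<kappa> u) *\<^sub>R (fueter v m (lower u (lower s \<kappa>)) x * fueter_variable v m u x))"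
      unfolding scaleR_sum_right
    proof (intro sum.cong refl)
      fix u
      have "real (\<kappa> u) * real (lower u \<kappa> s) = real (\<kappa> s) * real (lower s \<kappa> u)"
        using lower_coeff_symmetric[of \<kappa> u s] by (metis of_nat_mult)
      moreover have "fueter v m (lower s (lower u \<kappa>)) x = fueter v m (lower u (lower s \<kappa>)) x"
        using lower_commute[where u = s and s = u and \<kappa> = \<kappa>] by (simp only:)
      ultimately show "real (\<kappa> u) *\<^sub>R ((real (lower u \<kappa> s) *\<^sub>R fueter v m (lower s (lower u \<kappa>)) x) * fueter_variable v m u x)
        = real (\<kappa> s) *\<^sub>R real (lower s \<kappa> u) *\<^sub>R (fueter v m (lower u (lower s \<kappa>)) x * fueter_variable v m u x)"
        by (simp only: mult_scaleR_left scaleR_scaleR)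
    qed
    also have "\<dots> = real (\<kappa> s) *\<^sub>R (real n *\<^sub>R fueter v m (lower s \<kappa>) x)"
    proof (cases "\<kappa> s = 0")
      case False
      then have "sum (lower s \<kappa>) {1..m} = n"
        using sum_lower[of "{1..m}" s \<kappa>] s Suc.hyps(2) by simp
      then show ?thesis using fueter_recursion[of "lower s \<kappa>" m v x] by (simp only:)
    qed simp
    finally have 1: "(\<Sum>u=1..m. real (\<kappa> u) *\<^sub>R ((real (lower u \<kappa> s) *\<^sub>R fueter v m (lower s (lower u \<kappa>)) x) * fueter_variable v m u x))
       = real (\<kappa> s) *\<^sub>R (real n *\<^sub>R fueter v m (lower s \<kappa>) x)" .
    have "(\<Sum>u=1..m. real (\<kappa> u) *\<^sub>R (fueter v m (lower u \<kappa>) x * (if s = 0 then - v u else if s = u then 1 else 0)))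
      = (\<Sum>u=1..m. if u = s then real (\<kappa> s) *\<^sub>R fueter v m (lower s \<kappa>) x else 0)"
      using s by (intro sum.cong) auto
    also have "\<dots> = real (\<kappa> s) *\<^sub>R fueter v m (lower s \<kappa>) x" using s by simp
    finally have 2: "(\<Sum>u=1..m. real (\<kappa> u) *\<^sub>R (fueter v m (lower u \<kappa>) x * (if s = 0 then - v u else if s = u then 1 else 0)))
      = real (\<kappa> s) *\<^sub>R fueter v m (lower s \<kappa>) x" .
    show "(\<Sum>u=1..m. real (\<kappa> u) *\<^sub>R (fueter v m (lower u \<kappa>) x * (if s = 0 then - v u else if s = u then 1 else 0)
       + (real (lower u \<kappa> s) *\<^sub>R fueter v m (lower s (lower u \<kappa>)) x) * fueter_variable v m u x))
       = real (Suc n) *\<^sub>R (real (\<kappa> s) *\<^sub>R fueter v m (lower s \<kappa>) x)"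
      unfolding scaleR_add_right sum.distrib 1 2 by (simp add: algebra_simps)
  qed
qed

text \<open>
  The derivatives of the polynomial factors give \<open>n\<close> copies of the value, with \<open>v\<^sub>s\<close> on the left. Those
  of the variables \<open>\<zeta>\<^sub>s\<close> put \<open>v\<^sub>s\<close> on the right; the commutation identity turns them into the missing
  copy.
\<close>

lemma has_vector_derivative_fueter_0:
  assumes x: "x \<in> M"
  shows "((\<lambda>\<epsilon>. fueter v m \<kappa> (x + \<epsilon> *\<^sub>R v 0)) has_vector_derivative
    - (\<Sum>s=1..m. real (\<kappa> s) *\<^sub>R (v s * fueter v m (lower s \<kappa>) x))) (at 0)"
proof (induction "sum \<kappa> {1..m}" arbitrary: \<kappa>)
  case 0
  then show ?case by (simp add: fueter_degree_0)
next
  case (Suc n)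
  let ?S = "\<lambda>\<kappa>. \<Sum>s=1..m. real (\<kappa> s) *\<^sub>R (v s * fueter v m (lower s \<kappa>) x)"
  show ?case
  proof (rule has_vector_derivative_fueter_step[where D = "\<lambda>\<kappa>. - ?S \<kappa>", OF x])
    show "sum \<kappa> {1..m} = Suc n" using Suc.hyps(2) by simp
    show "((\<lambda>\<epsilon>. fueter v m (lower u \<kappa>) (x + \<epsilon> *\<^sub>R v 0)) has_vector_derivative - ?S (lower u \<kappa>)) (at 0)"
      if "u \<in> {1..m}" "0 < \<kappa> u" for u
      by (rule Suc.hyps(1)) (use sum_lower[of "{1..m}" u \<kappa>] that Suc.hyps(2) in simp)
    have "real n *\<^sub>R ?S \<kappa> = (\<Sum>s=1..m. \<Sum>u=1..m. real (\<kappa> s * lower s \<kappa> u) *\<^sub>R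
       (v s * (fueter v m (lower u (lower s \<kappa>)) x * fueter_variable v m u x)))"
      by (rule fueter_weighted_recursion) (use Suc.hyps(2) in \<open>auto simp: linear_iff algebra_simps\<close>)
    also have "\<dots> = (\<Sum>u=1..m. \<Sum>s=1..m. real (\<kappa> s * lower s \<kappa> u) *\<^sub>R
       (v s * (fueter v m (lower u (lower s \<kappa>)) x * fueter_variable v m u x)))"
      by (rule sum.swap)
    also have "\<dots> = (\<Sum>u=1..m. real (\<kappa> u) *\<^sub>R (?S (lower u \<kappa>) * fueter_variable v m u x))"
      unfolding sum_distrib_right scaleR_sum_right
    proof (intro sum.cong refl)
      fix u s
      have "real (\<kappa> s * lower s \<kappa> u) = real (\<kappa> u) * real (lower u \<kappa> s)"
        using lower_coeff_symmetric[of \<kappa> s u] by (metis of_nat_mult)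
      moreover have "fueter v m (lower u (lower s \<kappa>)) x = fueter v m (lower s (lower u \<kappa>)) x"
        using lower_commute[where u = s and s = u and \<kappa> = \<kappa>] by (simp only:)
      ultimately show "real (\<kappa> s * lower s \<kappa> u) *\<^sub>R
          (v s * (fueter v m (lower u (lower s \<kappa>)) x * fueter_variable v m u x)) =
         real (\<kappa> u) *\<^sub>R (real (lower u \<kappa> s) *\<^sub>R (v s * fueter v m (lower s (lower u \<kappa>)) x) * fueter_variable v m u x)"
        by (simp only: mult_scaleR_left scaleR_scaleR mult.assoc)
    qed
    finally have 1: "(\<Sum>u=1..m. real (\<kappa> u) *\<^sub>R (?S (lower u \<kappa>) * fueter_variable v m u x)) = real n *\<^sub>R ?S \<kappa>" ..
    have "(\<Sum>u=1..m. real (\<kappa> u) *\<^sub>R (fueter v m (lower u \<kappa>) x * (if (0::nat) = 0 then - v u else if 0 = u then 1 else 0)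
       + (- ?S (lower u \<kappa>)) * fueter_variable v m u x))
      = - (\<Sum>u=1..m. real (\<kappa> u) *\<^sub>R (fueter v m (lower u \<kappa>) x * v u))
        - (\<Sum>u=1..m. real (\<kappa> u) *\<^sub>R (?S (lower u \<kappa>) * fueter_variable v m u x))"
      by (simp only: scaleR_add_right sum.distrib sum_negf mult_minus_left mult_minus_right
          scaleR_minus_right if_True simp_thms diff_conv_add_uminus)
    also have "\<dots> = real (Suc n) *\<^sub>R (- ?S \<kappa>)"
      unfolding 1 fueter_commutation[symmetric] by (simp add: algebra_simps)
    finally show "(\<Sum>u=1..m. real (\<kappa> u) *\<^sub>R (fueter v m (lower u \<kappa>) x * (if (0::nat) = 0 then - v u else if 0 = u then 1 else 0)
       + (- ?S (lower u \<kappa>)) * fueter_variable v m u x)) = real (Suc n) *\<^sub>R (- ?S \<kappa>)" .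
  qed simp
qed

text \<open>
  By the two derivative formulas, \<open>\<partial>\<^sub>0\<close> of a Fueter polynomial cancels the sum of the \<open>v\<^sub>s \<partial>\<^sub>s\<close>. Right
  coefficients do not interfere because the operator multiplies from the left, by associativity.
\<close>

lemma fueter_combination_monogenic:
  assumes f: "\<forall>x\<in>M. f x = (\<Sum>\<kappa>\<in>I. fueter v m \<kappa> x * b \<kappa>)"
    and I: "\<And>\<kappa>. \<kappa> \<in> I \<Longrightarrow> sum \<kappa> {1..m} = k"
  shows "f \<in> monogenic_polynomials M v m k"
proof -
  have "homogeneous_polynomial_map v m k (\<lambda>x. \<Sum>\<kappa>\<in>I. fueter v m \<kappa> x * b \<kappa>)"
    by (intro homogeneous_polynomial_map_sum homogeneous_polynomial_map_right_mult
        homogeneous_polynomial_map_fueter I)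
  then have hom: "homogeneous_polynomial_map v m k f"
    using f by (simp add: homogeneous_polynomial_map_iff)
  have "dbar v m f x = 0" if x: "x \<in> M" for x
  proof -
    let ?S = "\<lambda>\<kappa>. \<Sum>s=1..m. real (\<kappa> s) *\<^sub>R (v s * fueter v m (lower s \<kappa>) x)"
    have comb: "partial v s f x = (\<Sum>\<kappa>\<in>I. L \<kappa> * b \<kappa>)"
      if s: "s \<le> m" and L: "\<And>\<kappa>. ((\<lambda>\<epsilon>. fueter v m \<kappa> (x + \<epsilon> *\<^sub>R v s)) has_vector_derivative L \<kappa>) (at 0)" for s L
    proof (rule partial_eqI)
      have "((\<lambda>\<epsilon>. \<Sum>\<kappa>\<in>I. fueter v m \<kappa> (x + \<epsilon> *\<^sub>R v s) * b \<kappa>) has_vector_derivative (\<Sum>\<kappa>\<in>I. L \<kappa> * b \<kappa>)) (at 0)"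
        by (intro has_vector_derivative_sum bounded_linear.has_vector_derivative[OF
              bounded_bilinear.bounded_linear_left[OF bounded_bilinear_mult_euclidean]] L)
      then show "((\<lambda>\<epsilon>. f (x + \<epsilon> *\<^sub>R v s)) has_vector_derivative (\<Sum>\<kappa>\<in>I. L \<kappa> * b \<kappa>)) (at 0)"
        using has_vector_derivative_cong_M[OF f x s] by blast
    qed
    have p0: "partial v 0 f x = (\<Sum>\<kappa>\<in>I. - ?S \<kappa> * b \<kappa>)"
      by (rule comb) (use has_vector_derivative_fueter_0[OF x] in auto)
    have ps: "partial v s f x = (\<Sum>\<kappa>\<in>I. real (\<kappa> s) *\<^sub>R fueter v m (lower s \<kappa>) x * b \<kappa>)" if "s \<in> {1..m}" for s
      by (rule comb) (use has_vector_derivative_fueter[OF x that] that in auto)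
    have "dbar v m f x = partial v 0 f x + (\<Sum>s=1..m. v s * partial v s f x)"
      by (simp add: dbar_def atMost_atLeast0 sum.atLeast_Suc_atMost v0)
    also have "(\<Sum>s=1..m. v s * partial v s f x) =
        (\<Sum>s=1..m. \<Sum>\<kappa>\<in>I. real (\<kappa> s) *\<^sub>R (v s * fueter v m (lower s \<kappa>) x) * b \<kappa>)"
      by (intro sum.cong refl) (simp add: ps sum_distrib_left mult.assoc)
    also have "\<dots> = (\<Sum>\<kappa>\<in>I. ?S \<kappa> * b \<kappa>)"
      by (subst sum.swap) (simp add: sum_distrib_right)
    finally show ?thesis by (simp add: p0 sum_negf)
  qed
  then show ?thesis
    using hom C1_on_homogeneous_polynomial_map
    by (auto simp: monogenic_polynomials_def left_monogenic_def)
qed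

section \<open>The expansion in Fueter polynomials\<close>

lemma multi_indices_extend:
  "\<kappa> \<in> multi_indices {1..m} k \<longleftrightarrow> \<kappa> \<in> multi_indices {..m} k \<and> \<kappa> 0 = 0"
proof -
  have "sum \<kappa> {..m} = \<kappa> 0 + sum \<kappa> {1..m}"
    by (simp add: atMost_atLeast0 sum.atLeast_Suc_atMost)
  moreover have "(\<forall>s. s \<notin> {1..m} \<longrightarrow> \<kappa> s = 0) \<longleftrightarrow> (\<forall>s. s \<notin> {..m} \<longrightarrow> \<kappa> s = 0) \<and> \<kappa> 0 = 0"
    by (metis One_nat_def atLeastAtMost_iff atMost_iff le_zero_eq not_less_eq_eq)
  ultimately show ?thesis by (auto simp: multi_indices_def)
qed

text \<open>
  The multi-indices with \<open>\<alpha>\<^sub>0 \<noteq> 0\<close> drop out on the right because their monomials contain a power of \<open>x\<^sub>0\<close>;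
  for the others, \<open>0\<^sup>0 = 1\<close>.
\<close>

lemma fueter_combination_on_hyperplane:
  assumes x: "coord v m 0 x = 0"
  shows "(\<Sum>\<kappa>\<in>multi_indices {1..m} k. fueter v m \<kappa> x * a \<kappa>) = hpoly k a x"
proof -
  have mon: "monomial \<alpha> x = 0 ^ \<alpha> 0 * (\<Prod>s=1..m. coord v m s x ^ \<alpha> s)" for \<alpha>
    by (simp add: monomial_def atMost_atLeast0 prod.atLeast_Suc_atMost x)
  have "(\<Sum>\<kappa>\<in>multi_indices {1..m} k. fueter v m \<kappa> x * a \<kappa>) =
      (\<Sum>\<kappa>\<in>multi_indices {1..m} k. monomial \<kappa> x *\<^sub>R a \<kappa>)"
  proof (intro sum.cong refl)
    fix \<kappa> assume "\<kappa> \<in> multi_indices {1..m} k"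
    then have "\<kappa> 0 = 0" by (simp only: multi_indices_extend)
    then show "fueter v m \<kappa> x * a \<kappa> = monomial \<kappa> x *\<^sub>R a \<kappa>"
      by (simp add: mon fueter_on_hyperplane[OF x] scaleR_conv_of_real)
  qed
  also have "\<dots> = hpoly k a x"
    unfolding hpoly_def
    by (intro sum.mono_neutral_left finite_multi_indices) (auto simp: multi_indices_extend[unfolded One_nat_def] mon)
  finally show ?thesis .
qed

text \<open>
  Both sides are monogenic and agree for \<open>x\<^sub>0 = 0\<close>.
\<close>

lemma fueter_expansion:
  assumes P: "P \<in> monogenic_polynomials M v m k" and a: "\<forall>x\<in>M. P x = hpoly k a x" and x: "x \<in> M"
  shows "P x = (\<Sum>\<kappa>\<in>multi_indices {1..m} k. fueter v m \<kappa> x * a \<kappa>)"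
proof -
  define Q where "Q x = (\<Sum>\<kappa>\<in>multi_indices {1..m} k. fueter v m \<kappa> x * a \<kappa>)" for x
  have Q: "Q \<in> monogenic_polynomials M v m k"
    by (rule fueter_combination_monogenic) (auto simp: Q_def multi_indices_def)
  show ?thesis
    unfolding Q_def[symmetric]
    by (rule monogenic_polynomials_eqI[OF P Q _ x])
      (simp add: a Q_def fueter_combination_on_hyperplane del: One_nat_def)
qed

lemma right_independent_fueter:
  "right_independent_on M (multi_indices {1..m} k) (fueter v m)"
  unfolding right_independent_on_def
proof (intro allI impI ballI)
  fix a \<kappa>
  assume a: "\<forall>x\<in>M. (\<Sum>\<kappa>\<in>multi_indices {1..m} k. fueter v m \<kappa> x * a \<kappa>) = 0"
    and \<kappa>: "\<kappa> \<in> multi_indices {1..m} k"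
  have "hpoly k a x = hpoly k (\<lambda>_. 0) x" if "x \<in> M" "coord v m 0 x = 0" for x
    using a fueter_combination_on_hyperplane[OF that(2), where k = k and a = a] that(1) by (simp add: hpoly_def)
  from hpoly_eq_on_hyperplane[OF this] show "a \<kappa> = 0"
    using \<kappa> by (simp only: multi_indices_extend)
qed

lemma right_span_fueter:
  "right_span_on M (multi_indices {1..m} k) (fueter v m) = monogenic_polynomials M v m k"
proof (intro equalityI subsetI)
  fix f assume "f \<in> right_span_on M (multi_indices {1..m} k) (fueter v m)"
  then show "f \<in> monogenic_polynomials M v m k"
    unfolding right_span_on_def
    by (auto simp: multi_indices_def intro: fueter_combination_monogenic)
next
  fix P assume P: "P \<in> monogenic_polynomials M v m k"
  then obtain a where "\<forall>x\<in>M. P x = hpoly k a x"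
    using homogeneous_polynomial_map_iff by (auto simp: monogenic_polynomials_def)
  then show "P \<in> right_span_on M (multi_indices {1..m} k) (fueter v m)"
    using fueter_expansion[OF P] unfolding right_span_on_def by blast
qed

lemma fueter_taylor:
  assumes P: "P \<in> monogenic_polynomials M v m k" and x: "x \<in> M"
  shows "P x = (\<Sum>\<kappa>\<in>multi_indices {1..m} k. fueter v m \<kappa> x *
    ((1 / (\<Prod>s\<in>{1..m}. fact (\<kappa> s))) *\<^sub>R nabla v m (\<kappa>(0 := 0)) P 0))"
proof -
  obtain a where a: "\<forall>x\<in>M. P x = hpoly k a x"
    using P homogeneous_polynomial_map_iff by (auto simp: monogenic_polynomials_def)
  have "(1 / (\<Prod>s\<in>{1..m}. fact (\<kappa> s))) *\<^sub>R nabla v m (\<kappa>(0 := 0)) P 0 = a \<kappa>"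
    if "\<kappa> \<in> multi_indices {1..m} k" for \<kappa>
  proof -
    have \<kappa>: "\<kappa> \<in> multi_indices {..m} k" and 0: "\<kappa> 0 = 0"
      using that by (simp_all only: multi_indices_extend)
    from 0 have "\<kappa>(0 := 0) = \<kappa>" by auto
    moreover have "(\<Prod>i\<le>m. fact (\<kappa> i)) = (\<Prod>s\<in>{1..m}. fact (\<kappa> s) :: real)"
      by (simp add: atMost_atLeast0 prod.atLeast_Suc_atMost 0)
    ultimately show ?thesis
      using nabla_hpoly[OF a \<kappa>] by (simp add: prod_zero_iff)
  qed
  then show ?thesis using fueter_expansion[OF P a x] by simp
qed

end

theorem proposition3p6:
  fixes c :: "'a::{real_algebra_1,euclidean_space} \<Rightarrow> 'a"
    and M :: "'a set" and v :: "nat \<Rightarrow> 'a" and m k :: nat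
  assumes "star_involution c"
    and "imag_units c \<noteq> {}"
    and "hypercomplex_subspace c M"
    and "hypercomplex_basis c M m v"
  shows "right_basis_on M (monogenic_polynomials M v m k)
           (multi_indices {1..m} k) (\<lambda>\<kappa>. fueter_poly v m (\<lambda>s. int (\<kappa> s)))
       \<and> (\<forall>P\<in>monogenic_polynomials M v m k. \<forall>x\<in>M.
            P x = (\<Sum>\<kappa>\<in>multi_indices {1..m} k.
                     fueter_poly v m (\<lambda>s. int (\<kappa> s)) x *
                     ((1 / (\<Prod>s\<in>{1..m}. fact (\<kappa> s))) *\<^sub>R nabla v m (\<kappa>(0 := 0)) P 0)))"
proof -
  interpret coordinate_frame v m
    using assms(4) by unfold_locales (auto simp: hypercomplex_basis_def)
  have "M = span (v ` {..m})" using assms(4) by (simp add: hypercomplex_basis_def)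
  then show ?thesis
    unfolding right_basis_on_def
    using right_independent_fueter right_span_fueter fueter_taylor finite_multi_indices[of "{1..m}"]
    by simp
qed

end
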